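(* For every integer $n\ge 1$ and every $c\in\mathbb{Q}$, one has $\partial_n^{(c)}(\mathfrak{H}^0)\subset\mathfrak{H}^0$ and $\partial_n^{(c)}(\mathfrak{H}^0)\subset\ker Z$; that is, $Z(\partial_n^{(c)}(w))=0$ for all $w\in\mathfrak{H}^0$.
   Context: Let $\mathfrak{H}=\mathbb{Q}\langle x,y\rangle$ be the noncommutative polynomial algebra over $\mathbb{Q}$ in two indeterminates $x,y$, and $z=x+y$. Let $\mathfrak{H}^1=\mathbb{Q}+\mathfrak{H}y$ and $\mathfrak{H}^0=\mathbb{Q}+x\mathfrak{H}y$. Let $Z:\mathfrak{H}^0\to\mathbb{R}$ be the $\mathbb{Q}$-linear map with $Z(1)=0$ and $Z(x^{k_1-1}yx^{k_2-1}y\cdots x^{k_n-1}y)=\zeta(k_1,\ldots,k_n)=\sum_{m_1>\cdots>m_n>0}m_1^{-k_1}\cdots m_n^{-k_n}$ (for $k_1\ge2$, $k_i\ge1$). Products of operators denote composition, $[A,B]=AB-BA$, $\mathrm{ad}(A)(B)=[A,B]$. $H:\mathfrak{H}\to\mathfrak{H}$ is the $\mathbb{Q}$-linear map with $H(w)=\deg(w)\,w$ for every word $w$. $\partial_1$ is the derivation of $\mathfrak{H}$ with $\partial_1(x)=xy$, $\partial_1(y)=-xy$. For $c\in\mathbb{Q}$, $\theta^{(c)}$ is the unique $\mathbb{Q}$-linear map $\mathfrak{H}\to\mathfrak{H}$ with $\theta^{(c)}(x)=\frac12(xz+zx)$, $\theta^{(c)}(y)=\frac12(yz+zy)$ and $\theta^{(c)}(ww')=\theta^{(c)}(w)w'+w\,\theta^{(c)}(w')+c\,\partial_1(w)H(w')$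 for all $w,w'\in\mathfrak{H}$. For $n\ge1$, $\partial_n^{(c)}=\frac{1}{(n-1)!}\mathrm{ad}(\theta^{(c)})^{n-1}(\partial_1)$. *)

theory Defs
  imports "HOL-Analysis.Analysis" "HOL-Library.Function_Algebras"
begin

datatype letter = X | Y

type_synonym word = "letter list"

text \<open>Elements of the algebra are rational coefficient functions on words;
  the algebra itself consists of the finitely supported ones.\<close>
type_synonym ncpoly = "word \<Rightarrow> rat"

definition supp :: "ncpoly \<Rightarrow> word set" where
  "supp f = {w. f w \<noteq> 0}"

definition Halg :: "ncpoly set" where
  "Halg = {f. finite (supp f)}"

definition mon :: "word \<Rightarrow> ncpoly" where
  "mon w = (\<lambda>v. if v = w then 1 else 0)"

definition pmul :: "ncpoly \<Rightarrow> ncpoly \<Rightarrow> ncpoly" where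
  "pmul f g = (\<lambda>v. \<Sum>i\<le>length v. f (take i v) * g (drop i v))"

definition smul :: "rat \<Rightarrow> ncpoly \<Rightarrow> ncpoly" where
  "smul r f = (\<lambda>v. r * f v)"

definition px :: ncpoly where "px = mon [X]"
definition py :: ncpoly where "py = mon [Y]"
definition pz :: ncpoly where "pz = px + py"

definition lin :: "(word \<Rightarrow> ncpoly) \<Rightarrow> ncpoly \<Rightarrow> ncpoly" where
  "lin T f = (\<lambda>v. \<Sum>w\<in>supp f. f w * T w v)"

definition H0 :: "ncpoly set" where
  "H0 = {f \<in> Halg. \<forall>w\<in>supp f. w = [] \<or> (hd w = X \<and> last w = Y)}"

definition Hop :: "ncpoly \<Rightarrow> ncpoly" where
  "Hop = lin (\<lambda>w. smul (of_nat (length w)) (mon w))"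

fun d1_letter :: "letter \<Rightarrow> ncpoly" where
  "d1_letter X = mon [X, Y]"
| "d1_letter Y = - mon [X, Y]"

fun d1_word :: "word \<Rightarrow> ncpoly" where
  "d1_word [] = 0"
| "d1_word (a # w) = pmul (d1_letter a) (mon w) + pmul (mon [a]) (d1_word w)"

definition d1 :: "ncpoly \<Rightarrow> ncpoly" where
  "d1 = lin d1_word"

definition theta_word :: "rat \<Rightarrow> word \<Rightarrow> ncpoly" where
  "theta_word c = (THE T.
      T [X] = smul (1/2) (pmul px pz + pmul pz px) \<and>
      T [Y] = smul (1/2) (pmul py pz + pmul pz py) \<and>
      (\<forall>u v. T (u @ v) = pmul (T u) (mon v) + pmul (mon u) (T v)
                          + smul c (pmul (d1 (mon u)) (Hop (mon v)))))"

definition theta :: "rat \<Rightarrow> ncpoly \<Rightarrow> ncpoly" where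
  "theta c = lin (theta_word c)"

definition comm :: "(ncpoly \<Rightarrow> ncpoly) \<Rightarrow> (ncpoly \<Rightarrow> ncpoly) \<Rightarrow> ncpoly \<Rightarrow> ncpoly" where
  "comm A B = (\<lambda>f. A (B f) - B (A f))"

definition dn :: "rat \<Rightarrow> nat \<Rightarrow> ncpoly \<Rightarrow> ncpoly" where
  "dn c n = (\<lambda>f. smul (1 / of_nat (fact (n - 1))) ((((comm (theta c)) ^^ (n - 1)) d1) f))"

text \<open>Word x^(k1-1) y ... x^(kn-1) y  |->  (k1,...,kn).\<close>
fun blocks :: "nat \<Rightarrow> word \<Rightarrow> nat list" where
  "blocks k [] = []"
| "blocks k (X # w) = blocks (Suc k) w"
| "blocks k (Y # w) = Suc k # blocks 0 w"

definition mzv :: "nat list \<Rightarrow> real" where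
  "mzv ks = infsum (\<lambda>ms. \<Prod>i<length ks. 1 / (real (ms ! i) ^ (ks ! i)))
      {ms. length ms = length ks \<and> sorted_wrt (>) ms \<and> (\<forall>m\<in>set ms. 0 < m)}"

definition zeta_word :: "word \<Rightarrow> real" where
  "zeta_word w = (if w = [] then 0 else mzv (blocks 0 w))"

definition Z :: "ncpoly \<Rightarrow> real" where
  "Z f = (\<Sum>w\<in>supp f. of_rat (f w) * zeta_word w)"

end

theory Submission
  imports Defs
begin

text \<open>
  Let \<open>\<phi>\<close> be the involutive automorphism with \<open>\<phi>(x) = x + y\<close>, \<open>\<phi>(y) = - y\<close>, let \<open>*\<close> be the
  harmonic (quasi-shuffle) product on \<open>\<HH>\<^sup>1\<close> and write \<open>z\<^sub>k\<close> for \<open>x\<^bsup>k-1\<^esup>y\<close>.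

  Algebra. For \<open>w \<in> \<HH>\<^sup>1\<close> one has \<open>\<partial>\<^sub>n(x \<phi>(w)) = x \<phi>(- u\<^sub>n * w)\<close> with \<open>u\<^sub>n \<in> \<HH>y\<close>.  For \<open>n = 1\<close> this is a
  computation with \<open>u\<^sub>1 = z\<^sub>1\<close>.  After subtracting the left and right multiplications by \<open>z/2\<close>, the map
  \<open>\<theta>\<close> acts on \<open>x \<phi>(\<HH>\<^sup>1)\<close> through an operator \<open>P\<close> on \<open>\<HH>\<^sup>1\<close>, and \<open>P\<close> is a derivation of \<open>*\<close>; hence
  taking the commutator with \<open>\<theta>\<close> replaces multiplication by \<open>u\<close> by multiplication by \<open>P(u)\<close>.  The two
  subtracted terms do not matter because every \<open>\<partial>\<^sub>n\<close> commutes with multiplication by \<open>z\<close> on either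
  side; on the right this uses \<open>[\<partial>\<^sub>n, \<partial>\<^sub>1] = 0\<close>, which holds because \<open>*\<close> is associative and
  commutative.

  Analysis. It remains to see that \<open>Z(x \<phi>(u * v)) = 0\<close> for \<open>u, v \<in> \<HH>y\<close> (the linear part of Kawashima's
  relation).  Let \<open>S\<^sub>w(N)\<close> be the truncated multiple zeta sums; they are multiplicative for \<open>*\<close>.  With
  \<open>\<nabla> = 1 - E\<close>, where \<open>E\<close> is the shift, \<open>- Z(x \<phi>(w))\<close> is the limit of \<open>L\<^sub>M(S\<^sub>w) = \<Sum>\<^bsub>q<M\<^esub> \<nabla>\<^sup>q(S\<^sub>w(N)/N)(1)\<close>.
  If \<open>f\<close> and \<open>g\<close> vanish at 0 and have completely monotone increments, the Leibniz rule shows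
  \<open>L\<^sub>M(f g) \<ge> 0\<close> and \<open>\<Sum> L\<^sub>M(f g)/M < \<infinity>\<close>.  Each \<open>S\<^sub>w\<close> is a difference of two such functions, so the limit of
  \<open>L\<^sub>M(S\<^sub>u S\<^sub>v)\<close>, which exists, must be 0.

  Instead of polynomials, all operators are applied to functions on words, that is, to linear
  functionals: an operator \<open>A\<close> is represented by its transpose, which sends \<open>f\<close> to \<open>f \<circ> A\<close>.  Composition
  is therefore reversed.
\<close>

subsection \<open>Finite combinations of point evaluations\<close>

text \<open>The functionals that are finite linear combinations of evaluations at points of \<open>S\<close>; finiteness
  is what makes limits and other such functionals commute with them.\<close>
inductive flin :: "'a set \<Rightarrow> (('a \<Rightarrow> real) \<Rightarrow> real) \<Rightarrow> bool" for S where
  flin_zero: "flin S (\<lambda>f. 0)"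
| flin_eval: "x \<in> S \<Longrightarrow> flin S (\<lambda>f. f x)"
| flin_plus: "flin S \<phi> \<Longrightarrow> flin S \<psi> \<Longrightarrow> flin S (\<lambda>f. \<phi> f + \<psi> f)"
| flin_mult: "flin S \<phi> \<Longrightarrow> flin S (\<lambda>f. r * \<phi> f)"

lemma flin_uminus: "flin S \<phi> \<Longrightarrow> flin S (\<lambda>f. - \<phi> f)"
  using flin_mult[of S \<phi> "-1"] by simp

lemma flin_minus: "flin S \<phi> \<Longrightarrow> flin S \<psi> \<Longrightarrow> flin S (\<lambda>f. \<phi> f - \<psi> f)"
  using flin_plus[OF _ flin_uminus, of S \<phi> \<psi>] by simp

lemma flin_divide: "flin S \<phi> \<Longrightarrow> flin S (\<lambda>f. \<phi> f / r)"
  using flin_mult[of S \<phi> "inverse r"] by (simp add: field_simps)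

lemma flin_comp:
  assumes "flin S \<phi>" "\<And>x. x \<in> S \<Longrightarrow> flin S' (\<lambda>f. F f x)"
  shows "flin S' (\<lambda>f. \<phi> (F f))"
  using assms by induction (auto intro: flin.intros)

lemma flin_reindex:
  assumes "flin S \<phi>" "\<And>x. x \<in> S \<Longrightarrow> g x \<in> S'"
  shows "flin S' (\<lambda>f. \<phi> (\<lambda>x. f (g x)))"
  using assms by (intro flin_comp[of S \<phi> S' "\<lambda>f x. f (g x)"]) (auto intro: flin_eval)

lemma flin_of_add: "flin S \<phi> \<Longrightarrow> \<phi> (\<lambda>x. f x + g x) = \<phi> f + \<phi> g"
  by (induction rule: flin.induct) (auto simp: algebra_simps)

lemma flin_of_mult: "flin S \<phi> \<Longrightarrow> \<phi> (\<lambda>x. r * f x) = r * \<phi> f"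
  by (induction rule: flin.induct) (auto simp: algebra_simps)

lemma flin_of_diff: "flin S \<phi> \<Longrightarrow> \<phi> (\<lambda>x. f x - g x) = \<phi> f - \<phi> g"
  using flin_of_add[of S \<phi> f "\<lambda>x. -1 * g x"] flin_of_mult[of S \<phi> "-1" g] by simp

lemma flin_of_uminus: "flin S \<phi> \<Longrightarrow> \<phi> (\<lambda>x. - f x) = - \<phi> f"
  by (induction rule: flin.induct) (auto simp: algebra_simps)

lemma flin_of_zero: "flin S \<phi> \<Longrightarrow> \<phi> (\<lambda>x. 0) = 0"
  by (induction rule: flin.induct) auto

lemma flin_of_divide: "flin S \<phi> \<Longrightarrow> \<phi> (\<lambda>x. f x / r) = \<phi> f / r"
  by (induction rule: flin.induct) (auto simp: add_divide_distrib)

lemma flin_of_sum: "flin S \<phi> \<Longrightarrow> \<phi> (\<lambda>x. \<Sum>i\<in>I. f i x) = (\<Sum>i\<in>I. \<phi> (f i))"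
  by (induction rule: flin.induct) (auto simp: sum.distrib sum_distrib_left)

lemma flin_cong: "flin S \<phi> \<Longrightarrow> (\<And>x. x \<in> S \<Longrightarrow> f x = g x) \<Longrightarrow> \<phi> f = \<phi> g"
  by (induction rule: flin.induct) auto

lemma flin_tendsto:
  "flin S \<phi> \<Longrightarrow> (\<And>x. x \<in> S \<Longrightarrow> (\<lambda>n. f n x) \<longlonglongrightarrow> g x) \<Longrightarrow> (\<lambda>n. \<phi> (f n)) \<longlonglongrightarrow> \<phi> g"
  by (induction rule: flin.induct) (auto intro!: tendsto_intros)

text \<open>A Fubini rule; both functionals are finite sums, so no convergence is involved.\<close>

lemma flin_swap:
  assumes "flin S \<phi>" "flin S' \<psi>"
  shows "\<phi> (\<lambda>x. \<psi> (\<lambda>y. f x y)) = \<psi> (\<lambda>y. \<phi> (\<lambda>x. f x y))"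
  using assms(1)
  by induction (simp_all add: flin_of_zero[OF assms(2)] flin_of_add[OF assms(2)] flin_of_mult[OF assms(2)])

lemmas flin_of = flin_of_add flin_of_diff flin_of_uminus flin_of_mult flin_of_divide flin_of_zero

subsection \<open>The operators conjugated by the automorphism\<close>

fun phi_dual :: "(word \<Rightarrow> real) \<Rightarrow> word \<Rightarrow> real" where
  "phi_dual f [] = f []"
| "phi_dual f (X # w) = phi_dual (\<lambda>u. f (X # u) + f (Y # u)) w"
| "phi_dual f (Y # w) = - phi_dual (\<lambda>u. f (Y # u)) w"

text \<open>Transposes of \<open>\<phi> \<circ> \<partial>\<^sub>1 \<circ> \<phi>\<close>, of \<open>\<phi> \<circ> \<theta> \<circ> \<phi>\<close> and of the iterated commutators \<open>ad(\<theta>)\<^sup>n(\<partial>\<^sub>1)\<close>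
  conjugated by \<open>\<phi>\<close>.\<close>
fun conj_d1 :: "(word \<Rightarrow> real) \<Rightarrow> word \<Rightarrow> real" where
  "conj_d1 f [] = 0"
| "conj_d1 f (X # w) = conj_d1 (\<lambda>u. f (X # u)) w"
| "conj_d1 f (Y # w) = - (f (X # Y # w) + f (Y # Y # w)) + conj_d1 (\<lambda>u. f (Y # u)) w"

fun conj_theta :: "real \<Rightarrow> (word \<Rightarrow> real) \<Rightarrow> word \<Rightarrow> real" where
  "conj_theta c f [] = 0"
| "conj_theta c f (X # w) = f (X # X # w) + conj_theta c (\<lambda>u. f (X # u)) w"
| "conj_theta c f (Y # w) = (f (X # Y # w) + f (Y # X # w)) / 2 + conj_theta c (\<lambda>u. f (Y # u)) w
     - c * real (length w) * (f (X # Y # w) + f (Y # Y # w))"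

fun conj_ad :: "real \<Rightarrow> nat \<Rightarrow> (word \<Rightarrow> real) \<Rightarrow> word \<Rightarrow> real" where
  "conj_ad c 0 f = conj_d1 f"
| "conj_ad c (Suc n) f = (\<lambda>w. conj_ad c n (conj_theta c f) w - conj_theta c (conj_ad c n f) w)"

lemma flin_phi_dual: "flin UNIV (\<lambda>f. phi_dual f w)"
proof (induction w)
  case Nil show ?case by (auto intro: flin_eval)
next
  case (Cons a w)
  show ?case
  proof (cases a)
    case X
    have "flin UNIV (\<lambda>f. f (X # u) + f (Y # u))" for u :: word
      by (intro flin_plus flin_eval) auto
    then have "flin UNIV (\<lambda>f. phi_dual (\<lambda>u. f (X # u) + f (Y # u)) w)"
      by (intro flin_comp[OF Cons, of UNIV "\<lambda>f u. f (X # u) + f (Y # u)"])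
    then show ?thesis using X by simp
  next
    case Y
    then show ?thesis using flin_reindex[OF Cons, of "(#) Y" UNIV] by (auto intro: flin_uminus)
  qed
qed

lemma flin_conj_d1: "flin UNIV (\<lambda>f. conj_d1 f w)"
proof (induction w)
  case Nil show ?case by (auto intro: flin_zero)
next
  case (Cons a w)
  show ?case using flin_reindex[OF Cons, of "(#) a" UNIV]
    by (cases a) (auto intro!: flin_plus flin_uminus flin_minus flin_eval)
qed

lemma flin_conj_theta: "flin UNIV (\<lambda>f. conj_theta c f w)"
proof (induction w)
  case Nil show ?case by (auto intro: flin_zero)
next
  case (Cons a w)
  show ?case using flin_reindex[OF Cons, of "(#) a" UNIV]
    by (cases a) (auto intro!: flin_plus flin_mult flin_divide flin_minus flin_eval)
qed

lemma flin_conj_ad: "flin UNIV (\<lambda>f. conj_ad c n f w)"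
proof (induction n arbitrary: w)
  case 0 show ?case by (simp add: flin_conj_d1)
next
  case (Suc n)
  show ?case using flin_comp[OF Suc, of UNIV "conj_theta c"] flin_comp[OF flin_conj_theta, of UNIV "conj_ad c n"]
    by (auto intro!: flin_minus simp: flin_conj_theta Suc)
qed

lemmas phi_dual_lin = flin_of[OF flin_phi_dual]
lemmas conj_d1_lin = flin_of[OF flin_conj_d1]
lemmas conj_theta_lin = flin_of[OF flin_conj_theta]
lemmas conj_ad_lin = flin_of[OF flin_conj_ad]

text \<open>\<open>d1\<close> kills z, and \<phi>(x) = z; hence the conjugated derivation passes a
  final x.\<close>

lemma conj_d1_snoc: "conj_d1 f (w @ [X]) = conj_d1 (\<lambda>u. f (u @ [X])) w"
  by (induction f w rule: conj_d1.induct) auto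

text \<open>Uses \<theta>(z) = z z and H(z) = z. The last term is why commutation with
  \<open>conj_d1\<close> is needed below.\<close>

lemma conj_theta_snoc: "conj_theta c f (w @ [X]) = conj_theta c (\<lambda>u. f (u @ [X])) w + f (w @ [X, X])
    + c * conj_d1 (\<lambda>u. f (u @ [X])) w"
  by (induction c f w rule: conj_theta.induct) (auto simp: algebra_simps)

lemma conj_theta_z: "conj_theta c f (X # w) + conj_theta c f (Y # w) =
   (f (X # X # w) + f (X # Y # w)) / 2 + (f (X # X # w) + f (Y # X # w)) / 2
   + conj_theta c (\<lambda>u. f (X # u) + f (Y # u)) w - c * real (length w) * (f (X # Y # w) + f (Y # Y # w))"
  by (simp add: conj_theta_lin field_simps)

subsection \<open>The harmonic product and its derivation\<close>

text \<open>An entry \<open>k\<close> stands for \<open>z\<^bsub>k+1\<^esub> = x\<^sup>k y\<close>, so the lists encode exactly the words of \<open>\<HH>\<^sup>1\<close>.\<close>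
fun enc :: "nat list \<Rightarrow> word" where
  "enc [] = []"
| "enc (k # ks) = replicate k X @ Y # enc ks"

fun weight :: "nat list \<Rightarrow> nat" where
  "weight [] = 0" | "weight (k # ks) = Suc k + weight ks"

lemma length_enc [simp]: "length (enc ks) = weight ks"
  by (induction ks) auto

text \<open>\<open>harm f u v = f(u * v)\<close>; entries are shifted by one, whence the \<open>Suc (a + b)\<close> for \<open>z\<^bsub>a+1\<^esub>z\<^bsub>b+1\<^esub> \<mapsto> z\<^bsub>a+b+2\<^esub>\<close>.\<close>
fun harm :: "(nat list \<Rightarrow> real) \<Rightarrow> nat list \<Rightarrow> nat list \<Rightarrow> real" where
  "harm f [] v = f v"
| "harm f (a # u) [] = f (a # u)"
| "harm f (a # u) (b # v) = harm (\<lambda>w. f (a # w)) u (b # v) + harm (\<lambda>w. f (b # w)) (a # u) v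
     + harm (\<lambda>w. f (Suc (a + b) # w)) u v"

lemma harm_Nil [simp]: "harm f u [] = f u" by (cases u) auto

fun z1_mult :: "(nat list \<Rightarrow> real) \<Rightarrow> nat list \<Rightarrow> real" where
  "z1_mult f [] = f [0]"
| "z1_mult f (k # w) = f (0 # k # w) + f (Suc k # w) + z1_mult (\<lambda>u. f (k # u)) w"

text \<open>The transpose of the derivation \<open>P\<close>.  On quasi-symmetric functions in variables \<open>t\<^sub>p\<close> it is
  \<open>\<Sum>\<^sub>p t\<^sub>p\<^sup>2 \<partial>\<^sub>p - c \<Sum>\<^bsub>q<p\<^esub> t\<^sub>p t\<^sub>q \<partial>\<^sub>q\<close>, which explains the derivation property.\<close>
fun harm_deriv :: "real \<Rightarrow> (nat list \<Rightarrow> real) \<Rightarrow> nat list \<Rightarrow> real" where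
  "harm_deriv c f [] = 0"
| "harm_deriv c f (k # w) = real (Suc k) * (f (Suc k # w) - c * f (0 # k # w)) + harm_deriv c (\<lambda>u. f (k # u)) w
     - c * real (weight w) * (f (0 # k # w) + f (Suc k # w))"

lemma harm_induct [case_names Nil1 Nil2 Cons]:
  fixes P :: "nat list \<Rightarrow> nat list \<Rightarrow> bool"
  assumes "\<And>v. P [] v" "\<And>a u. P (a # u) []"
    "\<And>a u b v. P u (b # v) \<Longrightarrow> P (a # u) v \<Longrightarrow> P u v \<Longrightarrow> P (a # u) (b # v)"
  shows "P u v"
  using harm.induct[of "\<lambda>_. P"] assms by metis

text \<open>A product u * v involves the empty word only if both factors are empty.\<close>

lemma flin_harm:
  "flin (if u = [] \<and> v = [] then UNIV else {w. w \<noteq> []}) (\<lambda>f. harm f u v)"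
proof -
  have gen: "flin {w. w \<noteq> []} (\<lambda>f. harm (\<lambda>w. f (a # w)) u v)"
    if "flin S (\<lambda>f. harm f u v)" for u v a S
    using flin_reindex[OF that, of "(#) a" "{w. w \<noteq> []}"] by simp
  show ?thesis
  proof (induction u v rule: harm_induct)
    case (Cons a u b v)
    show ?case using Cons[THEN gen] by (auto intro!: flin_plus)
  qed (auto intro!: flin_eval)
qed

lemma flin_z1_mult: "flin {w. w \<noteq> []} (\<lambda>f. z1_mult f w)"
proof (induction w)
  case (Cons a w)
  show ?case using flin_reindex[OF Cons, of "(#) a" "{w. w \<noteq> []}"]
    by (auto intro!: flin_plus flin_eval)
qed (auto intro: flin_eval)

lemma flin_harm_deriv: "flin {w. w \<noteq> []} (\<lambda>f. harm_deriv c f w)"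
proof (induction w)
  case (Cons a w)
  show ?case using flin_reindex[OF Cons, of "(#) a" "{w. w \<noteq> []}"]
    by (auto intro!: flin_plus flin_mult flin_minus flin_eval)
qed (auto intro: flin_zero)

lemmas harm_lin = flin_of[OF flin_harm]
lemmas z1_mult_lin = flin_of[OF flin_z1_mult]
lemmas harm_deriv_lin = flin_of[OF flin_harm_deriv]

lemma harm_0_left: "harm f [0] w = z1_mult f w"
  by (induction w arbitrary: f) auto

lemma harm_0_right: "harm f w [0] = z1_mult f w"
  by (induction w arbitrary: f) auto

text \<open>Dual form of associativity and commutativity with one factor equal to z_1.\<close>

lemma harm_z1_mult: "harm (z1_mult f) v w = z1_mult (\<lambda>p. harm f v p) w"
proof (induction f v w rule: harm.induct)
  case (3 f a u b v)
  then show ?case by (simp add: harm_lin z1_mult_lin)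
qed (auto simp: harm_0_right)

text \<open>All three terms of the recursion have the same weight, since \<open>Suc (a + b)\<close>
  carries the joint weight of the entries a and b.\<close>

lemma harm_weight: "harm (\<lambda>p. real (weight p) * f p) u v = real (weight u + weight v) * harm f u v"
proof (induction f u v rule: harm.induct)
  case (3 f a u b v)
  then show ?case by (simp add: harm_lin algebra_simps)
qed auto

lemma harm_harm_deriv_Cons:
  "harm (\<lambda>w. harm_deriv c f (a # w)) u v =
     real (Suc a) * (harm (\<lambda>w. f (Suc a # w)) u v - c * harm (\<lambda>w. f (0 # a # w)) u v)
     + harm (harm_deriv c (\<lambda>w. f (a # w))) u v
     - c * (real (weight u + weight v) * (harm (\<lambda>w. f (0 # a # w)) u v + harm (\<lambda>w. f (Suc a # w)) u v))"
  unfolding harm_lin(1)[symmetric] harm_weight[symmetric]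
  by (simp add: harm_lin mult.assoc del: of_nat_Suc)

lemma harm_harm_deriv: "harm (harm_deriv c f) u v = harm_deriv c (\<lambda>p. harm f p v) u + harm_deriv c (\<lambda>p. harm f u p) v"
proof (induction f u v rule: harm.induct)
  case (3 f a u b v)
  show ?case
    by (simp add: harm_harm_deriv_Cons 3 harm_deriv_lin del: harm_deriv.simps(2) of_nat_Suc)
       (simp add: harm_deriv_lin algebra_simps)
qed auto

fun harm_ad :: "real \<Rightarrow> nat \<Rightarrow> (nat list \<Rightarrow> real) \<Rightarrow> nat list \<Rightarrow> real" where
  "harm_ad c 0 f = (\<lambda>k. - z1_mult f k)"
| "harm_ad c (Suc n) f = (\<lambda>k. harm_ad c n (harm_deriv c f) k - harm_deriv c (harm_ad c n f) k)"

text \<open>The commutator of a derivation P with multiplication by u is multiplication by P(u).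
  Here \<psi> is evaluation at the multiplier, and its restriction to nonempty lists says that the
  multiplier lies in Hy.\<close>

lemma harm_ad_harm:
  "\<exists>\<psi>. flin {w. w \<noteq> []} \<psi> \<and> (\<forall>f k. harm_ad c n f k = \<psi> (\<lambda>u. harm f u k))"
proof (induction n)
  case 0
  show ?case
    by (rule exI[of _ "\<lambda>g. - g [0]"]) (auto intro: flin_uminus flin_eval simp: harm_0_left)
next
  case (Suc n)
  then obtain \<psi> where \<psi>: "flin {w. w \<noteq> []} \<psi>" "\<And>f k. harm_ad c n f k = \<psi> (\<lambda>u. harm f u k)"
    by blast
  have eq: "harm_ad c n f = (\<lambda>k. \<psi> (\<lambda>u. harm f u k))" for f
    using \<psi>(2) by blast
  have "harm_ad c (Suc n) f k = \<psi> (harm_deriv c (\<lambda>p. harm f p k))" for f k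
    by (simp add: eq harm_harm_deriv flin_of_add[OF \<psi>(1)] flin_swap[OF \<psi>(1) flin_harm_deriv])
  moreover have "flin {w. w \<noteq> []} (\<lambda>g. \<psi> (harm_deriv c g))"
    using flin_comp[OF \<psi>(1), of _ "harm_deriv c"] flin_harm_deriv by blast
  ultimately show ?case by blast
qed

lemma harm_ad_z1_mult: "harm_ad c n (z1_mult f) k = z1_mult (harm_ad c n f) k"
proof -
  obtain \<psi> where \<psi>: "flin {w. w \<noteq> []} \<psi>" "\<And>f k. harm_ad c n f k = \<psi> (\<lambda>u. harm f u k)"
    using harm_ad_harm by blast
  have eq: "harm_ad c n f = (\<lambda>k. \<psi> (\<lambda>u. harm f u k))" for f
    using \<psi>(2) by blast
  show ?thesis by (simp add: eq harm_z1_mult flin_swap[OF \<psi>(1) flin_z1_mult])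
qed

lemma harm_ad_eq_0:
  assumes "\<And>u v. u \<noteq> [] \<Longrightarrow> v \<noteq> [] \<Longrightarrow> harm f u v = 0" "k \<noteq> []"
  shows "harm_ad c n f k = 0"
proof -
  obtain \<psi> where \<psi>: "flin {w. w \<noteq> []} \<psi>" "\<And>f k. harm_ad c n f k = \<psi> (\<lambda>u. harm f u k)"
    using harm_ad_harm by blast
  have "\<psi> (\<lambda>u. harm f u k) = \<psi> (\<lambda>_. 0)"
    using assms by (intro flin_cong[OF \<psi>(1)]) auto
  then show ?thesis using \<psi> flin_of_zero by metis
qed

lemma flin_harm_ad: "flin UNIV (\<lambda>f. harm_ad c n f w)"
proof (induction n arbitrary: w)
  case 0 
  have "flin UNIV (\<lambda>f. z1_mult f w)" using flin_reindex[OF flin_z1_mult, of "\<lambda>x. x" UNIV] by simp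
  then show ?case by (auto intro: flin_uminus)
next
  case (Suc n)
  have *: "flin UNIV (\<lambda>f. harm_deriv c f w)" for w using flin_reindex[OF flin_harm_deriv, of "\<lambda>x. x" UNIV] by simp
  show ?case using flin_comp[OF Suc, of UNIV "harm_deriv c"] flin_comp[OF *, of UNIV "harm_ad c n"]
    by (auto intro!: flin_minus simp: * Suc)
qed

lemmas harm_ad_lin = flin_of[OF flin_harm_ad]

subsection \<open>Iterated commutators as harmonic multiplications\<close>

lemma enc_surj: "w = [] \<or> last w = Y \<Longrightarrow> \<exists>ks. w = enc ks"
proof (induction w)
  case Nil
  show ?case by (rule exI[of _ "[]"]) simp
next
  case (Cons a w)
  then obtain ks where ks: "w = enc ks" by (auto split: if_splits)
  show ?case
  proof (cases a)
    case Y
    then show ?thesis using ks by (intro exI[of _ "0 # ks"]) simp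
  next
    case X
    then obtain k ks' where "ks = k # ks'" using Cons.prems ks by (cases ks) auto
    then show ?thesis using X ks by (intro exI[of _ "Suc k # ks'"]) simp
  qed
qed

lemma conj_d1_replicate: "conj_d1 f (replicate k X @ w) = conj_d1 (\<lambda>u. f (replicate k X @ u)) w"
  by (induction k arbitrary: f) auto

lemma conj_theta_replicate: "conj_theta c f (replicate k X @ w) =
    real k * f (replicate (Suc k) X @ w) + conj_theta c (\<lambda>u. f (replicate k X @ u)) w"
  by (induction k arbitrary: f) (auto simp: algebra_simps replicate_app_Cons_same)

text \<open>The Leibniz rule inserts y after each z_k or raises k, but never inserts y at the front;
  the first term removes that insertion from z_1 * w.\<close>

lemma conj_d1_enc: "conj_d1 f (enc ks) = f (Y # enc ks) - z1_mult (\<lambda>ks. f (enc ks)) ks"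
  by (induction ks arbitrary: f) (auto simp: conj_d1_replicate replicate_app_Cons_same)

lemma conj_theta_enc: "conj_theta c f (enc ks) = harm_deriv c (\<lambda>ks. f (enc ks)) ks - f (X # enc ks) / 2
    + f (enc ks @ [X]) / 2 + c * real (weight ks) * f (Y # enc ks)"
proof (induction ks arbitrary: f)
  case (Cons k ks)
  show ?case
    by (simp add: conj_theta_replicate Cons.IH replicate_app_Cons_same) (simp add: field_simps)
qed simp

text \<open>\<open>left_z f w = f(z w)\<close>; since \<open>\<phi>(z) = x\<close>, this is left multiplication by \<open>x\<close> before conjugation.\<close>
definition left_z :: "(word \<Rightarrow> real) \<Rightarrow> nat list \<Rightarrow> real" where
  "left_z f ks = f (X # enc ks) + f (Y # enc ks)"

text \<open>The correction y w from \<open>conj_d1_enc\<close> cancels against the derivative of the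
  factor z.\<close>

lemma left_z_conj_d1: "left_z (conj_d1 f) ks = - z1_mult (left_z f) ks"
  using conj_d1_enc[of "\<lambda>u. f (X # u) + f (Y # u)" ks]
  by (simp add: left_z_def[abs_def] conj_d1_lin)

text \<open>The terms with factor c and y in front of w cancel in the same way, leaving half of the
  multiplication by x on each side and the derivation.\<close>

lemma left_z_conj_theta: "left_z (conj_theta c f) ks = left_z (\<lambda>u. f (X # u)) ks / 2 + left_z (\<lambda>u. f (u @ [X])) ks / 2
    + harm_deriv c (left_z f) ks"
  unfolding left_z_def conj_theta_z conj_theta_enc left_z_def[abs_def] by (simp add: field_simps)

text \<open>The claims support one another: passing x on both sides removes the two halves in
  \<open>left_z_conj_theta\<close> from the commutator, and passing x on the right at the next level
  requires \<open>comm\<close>.\<close>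

lemma conj_ad_properties:
  "(\<forall>f. conj_ad c n f [] = 0) \<and>
   (\<forall>f w. conj_ad c n f (X # w) = conj_ad c n (\<lambda>u. f (X # u)) w) \<and>
   (\<forall>f w. conj_ad c n f (w @ [X]) = conj_ad c n (\<lambda>u. f (u @ [X])) w) \<and>
   (\<forall>f ks. left_z (conj_ad c n f) ks = harm_ad c n (left_z f) ks)"
proof (induction n)
  case 0
  show ?case by (simp add: conj_d1_snoc left_z_conj_d1)
next
  case (Suc n)
  then have nil: "conj_ad c n f [] = 0" and lx: "conj_ad c n f (X # w) = conj_ad c n (\<lambda>u. f (X # u)) w"
    and rx: "conj_ad c n f (w @ [X]) = conj_ad c n (\<lambda>u. f (u @ [X])) w"
    and left_z: "left_z (conj_ad c n f) ks = harm_ad c n (left_z f) ks" for f w ks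
    by auto
  have zf': "left_z (conj_ad c n f) = harm_ad c n (left_z f)" for f using left_z by auto
  \<comment> \<open>An x at either end is stripped off. For y v with v in H^1, use y = z - x: on z v
    both operators are harmonic multiplications, which commute.\<close>
  have comm: "conj_ad c n (conj_d1 f) w = conj_d1 (conj_ad c n f) w" for f w
  proof (induction "length w" arbitrary: f w rule: less_induct)
    case less
    show ?case
    proof (cases w)
      case Nil
      then show ?thesis by (simp add: nil)
    next
      case (Cons a v)
      have X: "conj_ad c n (conj_d1 f) (X # v) = conj_d1 (conj_ad c n f) (X # v)"
        using less[of v] Cons by (simp add: lx)
      show ?thesis
      proof (cases "v = [] \<or> last v = Y")
        case True
        then obtain ks where ks: "v = enc ks" using enc_surj by blast
        have "left_z (conj_ad c n (conj_d1 f)) ks = left_z (conj_d1 (conj_ad c n f)) ks"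
          by (simp add: left_z_conj_d1[abs_def] left_z zf' harm_ad_lin harm_ad_z1_mult)
        then show ?thesis using X Cons ks by (cases a) (auto simp: left_z_def)
      next
        case False
        then obtain v' where v': "v = v' @ [X]"
          by (metis append_butlast_last_id letter.exhaust)
        have "conj_ad c n (conj_d1 f) (a # v') = conj_d1 (conj_ad c n f) (a # v')" for f
          using less[of "a # v'"] Cons v' by simp
        then have "conj_ad c n (conj_d1 f) ((a # v') @ [X]) = conj_d1 (conj_ad c n f) ((a # v') @ [X])"
          unfolding rx conj_d1_snoc by simp
        then show ?thesis using Cons v' by simp
      qed
    qed
  qed
  have rx2: "conj_ad c n f (w @ [X, X]) = conj_ad c n (\<lambda>u. f (u @ [X, X])) w" for f w
    using rx[of f "w @ [X]"] rx[of "\<lambda>u. f (u @ [X])" w] by simp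
  show ?case
  proof (intro conjI allI)
    show "conj_ad c (Suc n) f [] = 0" for f by (simp add: nil)
    show "conj_ad c (Suc n) f (X # w) = conj_ad c (Suc n) (\<lambda>u. f (X # u)) w" for f w
      by (simp add: lx conj_ad_lin)
    show "conj_ad c (Suc n) f (w @ [X]) = conj_ad c (Suc n) (\<lambda>u. f (u @ [X])) w" for f w
      by (simp add: rx rx2 conj_theta_snoc conj_ad_lin comm)
    show "left_z (conj_ad c (Suc n) f) ks = harm_ad c (Suc n) (left_z f) ks" for f ks
    proof -
      have "left_z (conj_ad c (Suc n) f) ks = left_z (conj_ad c n (conj_theta c f)) ks - left_z (conj_theta c (conj_ad c n f)) ks"
        by (simp add: left_z_def)
      also have "left_z (conj_ad c n (conj_theta c f)) ks = harm_ad c n (\<lambda>ks. left_z (\<lambda>u. f (X # u)) ks / 2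
          + left_z (\<lambda>u. f (u @ [X])) ks / 2 + harm_deriv c (left_z f) ks) ks"
        unfolding left_z by (simp add: left_z_conj_theta[abs_def])
      also have "\<dots> - left_z (conj_theta c (conj_ad c n f)) ks = harm_ad c (Suc n) (left_z f) ks"
        unfolding left_z_conj_theta lx rx zf' by (simp add: harm_ad_lin)
      finally show ?thesis .
    qed
  qed
qed

section \<open>Transposes of the original operators and their conjugation by \<phi>\<close>

fun d1_dual :: "(word \<Rightarrow> real) \<Rightarrow> word \<Rightarrow> real" where
  "d1_dual f [] = 0"
| "d1_dual f (X # w) = f (X # Y # w) + d1_dual (\<lambda>u. f (X # u)) w"
| "d1_dual f (Y # w) = - f (X # Y # w) + d1_dual (\<lambda>u. f (Y # u)) w"

fun theta_dual :: "real \<Rightarrow> (word \<Rightarrow> real) \<Rightarrow> word \<Rightarrow> real" where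
  "theta_dual c f [] = 0"
| "theta_dual c f (X # w) = f (X # X # w) + (f (X # Y # w) + f (Y # X # w)) / 2
     + theta_dual c (\<lambda>u. f (X # u)) w + c * real (length w) * f (X # Y # w)"
| "theta_dual c f (Y # w) = f (Y # Y # w) + (f (X # Y # w) + f (Y # X # w)) / 2
     + theta_dual c (\<lambda>u. f (Y # u)) w - c * real (length w) * f (X # Y # w)"

fun ad_dual :: "real \<Rightarrow> nat \<Rightarrow> (word \<Rightarrow> real) \<Rightarrow> word \<Rightarrow> real" where
  "ad_dual c 0 f = d1_dual f"
| "ad_dual c (Suc n) f = (\<lambda>w. ad_dual c n (theta_dual c f) w - theta_dual c (ad_dual c n f) w)"

lemma flin_d1_dual: "flin UNIV (\<lambda>f. d1_dual f w)"
proof (induction w)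
  case Nil show ?case by (auto intro: flin_zero)
next
  case (Cons a w)
  show ?case using flin_reindex[OF Cons, of "(#) a" UNIV]
    by (cases a) (auto intro!: flin_plus flin_uminus flin_minus flin_eval)
qed

lemma flin_theta_dual: "flin UNIV (\<lambda>f. theta_dual c f w)"
proof (induction w)
  case Nil show ?case by (auto intro: flin_zero)
next
  case (Cons a w)
  show ?case using flin_reindex[OF Cons, of "(#) a" UNIV]
    by (cases a) (auto intro!: flin_plus flin_mult flin_divide flin_minus flin_eval)
qed

lemmas d1_dual_lin = flin_of[OF flin_d1_dual]
lemmas theta_dual_lin = flin_of[OF flin_theta_dual]

lemma phi_dual_d1_dual: "phi_dual (d1_dual f) w = conj_d1 (phi_dual f) w"
proof (induction f w rule: phi_dual.induct)
  case (2 f w)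
  then show ?case by (simp add: d1_dual_lin)
next
  case (3 f w)
  then show ?case by (simp add: phi_dual_lin conj_d1_lin)
qed simp

lemma phi_dual_length: "phi_dual (\<lambda>u. real (length u) * f u) w = real (length w) * phi_dual f w"
  by (induction f w rule: phi_dual.induct) (simp_all add: phi_dual_lin algebra_simps)

lemma phi_dual_theta_dual: "phi_dual (theta_dual c f) w = conj_theta c (phi_dual f) w"
proof (induction f w rule: phi_dual.induct)
  case (2 f w)
  \<comment> \<open>Since \<open>d1\<close> kills z, the terms with factor c cancel on z u.\<close>
  have "theta_dual c f (X # u) + theta_dual c f (Y # u) = (f (X # X # u) + f (X # Y # u)) + (f (Y # X # u) + f (Y # Y # u))
       + theta_dual c (\<lambda>u. f (X # u) + f (Y # u)) u" for u
    by (simp add: theta_dual_lin field_simps)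
  then show ?case using 2 by (simp add: phi_dual_lin del: theta_dual.simps)
next
  case (3 f w)
  then show ?case
    by (simp add: phi_dual_lin phi_dual_length mult.assoc conj_theta_lin) (simp add: field_simps)
qed simp

lemma phi_dual_ad_dual: "phi_dual (ad_dual c n f) w = conj_ad c n (phi_dual f) w"
proof (induction n arbitrary: f w)
  case 0
  then show ?case by (simp add: phi_dual_d1_dual)
next
  case (Suc n)
  have "phi_dual (theta_dual c f) = conj_theta c (phi_dual f)" "phi_dual (ad_dual c n f) = conj_ad c n (phi_dual f)" for f
    using Suc by (auto simp: phi_dual_theta_dual)
  then show ?case by (simp add: phi_dual_lin Suc phi_dual_theta_dual)
qed

lemma phi_dual_phi_dual: "phi_dual (phi_dual f) w = f w"
proof (induction w arbitrary: f)
  case (Cons a w)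
  then show ?case by (cases a) (simp_all add: phi_dual_lin)
qed simp

text \<open>\<phi> preserves Hy; recording this lets vanishing and limits on Hy pass through
  \<phi>.\<close>

lemma flin_phi_dual_Y: "w \<noteq> [] \<Longrightarrow> last w = Y \<Longrightarrow> flin {w. w \<noteq> [] \<and> last w = Y} (\<lambda>f. phi_dual f w)"
proof (induction w)
  case (Cons a w)
  let ?S = "{w. w \<noteq> [] \<and> last w = Y}"
  show ?case
  proof (cases "w = []")
    case True
    then show ?thesis using Cons.prems by (auto intro!: flin_uminus flin_eval)
  next
    case False
    then have IH: "flin ?S (\<lambda>f. phi_dual f w)" using Cons by auto
    show ?thesis
    proof (cases a)
      case X
      have "flin ?S (\<lambda>f. f (X # u) + f (Y # u))" if "u \<in> ?S" for u
        using that by (intro flin_plus flin_eval) auto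
      then have "flin ?S (\<lambda>f. phi_dual (\<lambda>u. f (X # u) + f (Y # u)) w)"
        by (intro flin_comp[OF IH, of ?S "\<lambda>f u. f (X # u) + f (Y # u)"]) auto
      then show ?thesis using X by simp
    next
      case Y
      then show ?thesis using flin_reindex[OF IH, of "(#) Y" ?S] by (auto intro: flin_uminus)
    qed
  qed
qed simp

lemma enc_eq_Nil [simp]: "enc ks = [] \<longleftrightarrow> ks = []"
  by (cases ks) auto

lemma last_enc: "ks \<noteq> [] \<Longrightarrow> enc ks \<noteq> [] \<and> last (enc ks) = Y"
  by (induction ks) auto

lemma left_z_phi_dual: "left_z (phi_dual f) ks = phi_dual (\<lambda>u. f (X # u)) (enc ks)"
  by (simp add: left_z_def phi_dual_lin)

lemma ad_dual_Nil: "ad_dual c n f [] = 0"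
  using phi_dual_ad_dual[of c n f "[]"] conj_ad_properties[of c n] by simp

text \<open>After conjugation the operator is a harmonic multiplication, so \<open>g\<close>
  vanishes on \<phi>(Hy), which is Hy because \<phi> is an involution.\<close>

lemma ad_dual_eq_0:
  assumes "\<And>u v. u \<noteq> [] \<Longrightarrow> v \<noteq> [] \<Longrightarrow> harm (left_z (phi_dual f)) u v = 0"
    and "w \<noteq> []" "last w = Y"
  shows "ad_dual c n f (X # w) = 0"
proof -
  define g where "g = (\<lambda>u. ad_dual c n f (X # u))"
  have z: "phi_dual g (enc ks) = 0" if "ks \<noteq> []" for ks
  proof -
    have "phi_dual (ad_dual c n f) = conj_ad c n (phi_dual f)" using phi_dual_ad_dual by auto
    then have "phi_dual g (enc ks) = harm_ad c n (left_z (phi_dual f)) ks"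
      using conj_ad_properties[of c n] by (simp add: g_def flip: left_z_phi_dual)
    then show ?thesis using harm_ad_eq_0[OF assms(1) that] by simp
  qed
  have "phi_dual g u = 0" if "u \<noteq> []" "last u = Y" for u
    using enc_surj[of u] z that by (metis enc.simps(1))
  then have "phi_dual (phi_dual g) w = phi_dual (\<lambda>_. 0) w"
    by (intro flin_cong[OF flin_phi_dual_Y[OF assms(2,3)]]) auto
  then show ?thesis by (simp add: phi_dual_phi_dual phi_dual_lin g_def)
qed

subsection \<open>Pairing polynomials with functions on words\<close>

definition pairing :: "(word \<Rightarrow> real) \<Rightarrow> ncpoly \<Rightarrow> real" where
  "pairing f p = (\<Sum>w\<in>supp p. of_rat (p w) * f w)"

lemma pairing_superset: "finite S \<Longrightarrow> supp p \<subseteq> S \<Longrightarrow> pairing f p = (\<Sum>w\<in>S. of_rat (p w) * f w)"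
  unfolding pairing_def by (rule sum.mono_neutral_left) (auto simp: supp_def)

lemma Halg_subset: "finite S \<Longrightarrow> supp p \<subseteq> S \<Longrightarrow> p \<in> Halg"
  by (auto simp: Halg_def intro: finite_subset)

lemma Halg_mon [simp]: "mon w \<in> Halg"
  by (rule Halg_subset[of "{w}"]) (auto simp: supp_def mon_def)

lemma Halg_0 [simp]: "0 \<in> Halg"
  by (simp add: Halg_def supp_def)

lemma Halg_add [simp]: "p \<in> Halg \<Longrightarrow> q \<in> Halg \<Longrightarrow> p + q \<in> Halg"
  by (rule Halg_subset[of "supp p \<union> supp q"]) (auto simp: Halg_def supp_def)

lemma Halg_diff [simp]: "p \<in> Halg \<Longrightarrow> q \<in> Halg \<Longrightarrow> p - q \<in> Halg"
  by (rule Halg_subset[of "supp p \<union> supp q"]) (auto simp: Halg_def supp_def)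

lemma Halg_uminus [simp]: "p \<in> Halg \<Longrightarrow> - p \<in> Halg"
  by (rule Halg_subset[of "supp p"]) (auto simp: Halg_def supp_def)

lemma Halg_smul [simp]: "p \<in> Halg \<Longrightarrow> smul r p \<in> Halg"
  by (rule Halg_subset[of "supp p"]) (auto simp: Halg_def supp_def smul_def)

lemmas Halg_fun [simp] = Halg_0[unfolded zero_fun_def] Halg_add[unfolded plus_fun_def]
  Halg_diff[unfolded fun_diff_def] Halg_uminus[unfolded fun_Compl_def]

lemma supp_pmul: "supp (pmul p q) \<subseteq> (\<lambda>(u, v). u @ v) ` (supp p \<times> supp q)"
proof
  fix w assume "w \<in> supp (pmul p q)"
  then obtain i where "p (take i w) * q (drop i w) \<noteq> 0"
    unfolding supp_def pmul_def by (auto elim: sum.not_neutral_contains_not_neutral)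
  then show "w \<in> (\<lambda>(u, v). u @ v) ` (supp p \<times> supp q)"
    by (auto simp: supp_def intro!: image_eqI[of _ _ "(take i w, drop i w)"])
qed

lemma Halg_pmul [simp]: "p \<in> Halg \<Longrightarrow> q \<in> Halg \<Longrightarrow> pmul p q \<in> Halg"
  by (rule Halg_subset[OF _ supp_pmul]) (auto simp: Halg_def)

lemma supp_lin: "supp (lin T p) \<subseteq> (\<Union>w\<in>supp p. supp (T w))"
proof
  fix v assume "v \<in> supp (lin T p)"
  then have "(\<Sum>w\<in>supp p. p w * T w v) \<noteq> 0" by (simp add: lin_def supp_def)
  then obtain w where "w \<in> supp p" "p w * T w v \<noteq> 0"
    by (rule sum.not_neutral_contains_not_neutral)
  then show "v \<in> (\<Union>w\<in>supp p. supp (T w))" by (auto simp: supp_def)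
qed

lemma Halg_lin [simp]: "p \<in> Halg \<Longrightarrow> (\<And>w. T w \<in> Halg) \<Longrightarrow> lin T p \<in> Halg"
  by (rule Halg_subset[OF _ supp_lin]) (auto simp: Halg_def)

lemma supp_mon: "supp (mon w) = {w}"
  by (auto simp: supp_def mon_def)

lemma pairing_mon [simp]: "pairing f (mon w) = f w"
  by (simp add: pairing_def supp_mon) (simp add: mon_def)

lemma lin_mon [simp]: "lin T (mon w) = T w"
  by (rule ext) (simp add: lin_def supp_mon, simp add: mon_def)

lemma pairing_0 [simp]: "pairing f 0 = 0"
  by (simp add: pairing_def)

lemma pairing_add [simp]: "p \<in> Halg \<Longrightarrow> q \<in> Halg \<Longrightarrow> pairing f (p + q) = pairing f p + pairing f q"
proof -
  assume "p \<in> Halg" "q \<in> Halg"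
  then have fin: "finite (supp p \<union> supp q)" by (simp add: Halg_def)
  have "supp (p + q) \<subseteq> supp p \<union> supp q" by (auto simp: supp_def)
  from pairing_superset[OF fin this] show ?thesis
    by (simp add: pairing_superset[OF fin] of_rat_add distrib_right sum.distrib)
qed

lemma pairing_smul [simp]: "p \<in> Halg \<Longrightarrow> pairing f (smul r p) = of_rat r * pairing f p"
  using pairing_superset[of "supp p" "smul r p" f]
  by (auto simp: Halg_def supp_def smul_def sum_distrib_left of_rat_mult pairing_def mult.assoc)

lemma pairing_uminus [simp]: "p \<in> Halg \<Longrightarrow> pairing f (- p) = - pairing f p"
  using pairing_superset[of "supp p" "- p" f]
  by (auto simp: Halg_def supp_def sum_negf of_rat_minus pairing_def)

lemma pairing_diff [simp]: "p \<in> Halg \<Longrightarrow> q \<in> Halg \<Longrightarrow> pairing f (p - q) = pairing f p - pairing f q"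
  using pairing_add[of p "- q" f] by (simp del: pairing_add)

lemmas pairing_fun [simp] = pairing_0[unfolded zero_fun_def] pairing_add[unfolded plus_fun_def]
  pairing_diff[unfolded fun_diff_def] pairing_uminus[unfolded fun_Compl_def]

lemma pairing_pmul [simp]:
  assumes "p \<in> Halg" "q \<in> Halg"
  shows "pairing f (pmul p q) = pairing (\<lambda>u. pairing (\<lambda>v. f (u @ v)) q) p"
proof -
  let ?S = "(\<lambda>(u, v). u @ v) ` (supp p \<times> supp q)"
  have fin: "finite (supp p)" "finite (supp q)" using assms by (auto simp: Halg_def)
  have "pairing f (pmul p q) = (\<Sum>w\<in>?S. of_rat (pmul p q w) * f w)"
    using fin by (intro pairing_superset supp_pmul) auto
  also have "\<dots> = (\<Sum>w\<in>?S. \<Sum>i\<le>length w. of_rat (p (take i w)) * of_rat (q (drop i w)) * f w)"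
    by (simp add: pmul_def of_rat_sum of_rat_mult sum_distrib_right)
  also have "\<dots> = (\<Sum>(w, i)\<in>Sigma ?S (\<lambda>w. {..length w}).
      of_rat (p (take i w)) * of_rat (q (drop i w)) * f w)"
    using fin by (intro sum.Sigma) auto
  also have "\<dots> = (\<Sum>(u, v)\<in>supp p \<times> supp q. of_rat (p u) * of_rat (q v) * f (u @ v))"
    (is "sum ?g _ = sum ?h _")
  proof -
    have "sum ?g (Sigma ?S (\<lambda>w. {..length w})) =
        sum ?g ((\<lambda>(u, v). (u @ v, length u)) ` (supp p \<times> supp q))"
    proof (rule sum.mono_neutral_right)
      show "\<forall>x\<in>Sigma ?S (\<lambda>w. {..length w}) - (\<lambda>(u, v). (u @ v, length u)) ` (supp p \<times> supp q). ?g x = 0"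
      proof (clarify, rule ccontr)
        fix w i
        assume *: "(w, i) \<notin> (\<lambda>(u, v). (u @ v, length u)) ` (supp p \<times> supp q)" "i \<le> length w"
          and "of_rat (p (take i w)) * of_rat (q (drop i w)) * f w \<noteq> 0"
        then have "(take i w, drop i w) \<in> supp p \<times> supp q" by (auto simp: supp_def)
        then have "(\<lambda>(u, v). (u @ v, length u)) (take i w, drop i w)
            \<in> (\<lambda>(u, v). (u @ v, length u)) ` (supp p \<times> supp q)" by blast
        then show False using * by simp
      qed
    qed (use fin in auto)
    also have "\<dots> = sum ?h (supp p \<times> supp q)"
      by (subst sum.reindex) (auto simp: inj_on_def intro: sum.cong)
    finally show ?thesis .
  qed
  also have "\<dots> = pairing (\<lambda>u. pairing (\<lambda>v. f (u @ v)) q) p"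
    unfolding pairing_def by (simp add: sum.cartesian_product[symmetric] sum_distrib_left mult.assoc)
  finally show ?thesis .
qed

lemma pairing_lin [simp]:
  assumes "p \<in> Halg" "\<And>w. T w \<in> Halg"
  shows "pairing f (lin T p) = pairing (\<lambda>w. pairing f (T w)) p"
proof -
  let ?S = "\<Union>w\<in>supp p. supp (T w)"
  have fin: "finite (supp p)" "finite ?S" using assms by (auto simp: Halg_def)
  have "pairing f (lin T p) = (\<Sum>v\<in>?S. of_rat (lin T p v) * f v)"
    using fin by (intro pairing_superset supp_lin) auto
  also have "\<dots> = (\<Sum>v\<in>?S. \<Sum>w\<in>supp p. of_rat (p w) * (of_rat (T w v) * f v))"
    by (simp add: lin_def of_rat_sum of_rat_mult sum_distrib_right mult.assoc)
  also have "\<dots> = (\<Sum>w\<in>supp p. \<Sum>v\<in>?S. of_rat (p w) * (of_rat (T w v) * f v))"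
    by (rule sum.swap)
  also have "\<dots> = (\<Sum>w\<in>supp p. of_rat (p w) * pairing f (T w))"
  proof (intro sum.cong refl)
    fix w assume "w \<in> supp p"
    then have "pairing f (T w) = (\<Sum>v\<in>?S. of_rat (T w v) * f v)"
      using fin by (intro pairing_superset) auto
    then show "(\<Sum>v\<in>?S. of_rat (p w) * (of_rat (T w v) * f v)) = of_rat (p w) * pairing f (T w)"
      by (simp add: sum_distrib_left)
  qed
  finally show ?thesis by (simp add: pairing_def)
qed

lemma pairing_indicator: "p \<in> Halg \<Longrightarrow> pairing (\<lambda>w. if w = v then 1 else 0) p = of_rat (p v)"
  by (auto simp: pairing_def Halg_def supp_def if_distrib cong: if_cong)

text \<open>Indicator functions recover coefficients, so identities in the algebra can be checked on
  transposes.\<close>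

lemma pairing_eqI: "p \<in> Halg \<Longrightarrow> q \<in> Halg \<Longrightarrow> (\<And>f. pairing f p = pairing f q) \<Longrightarrow> p = q"
  using pairing_indicator[of p] pairing_indicator[of q] by (metis ext of_rat_eq_iff)

lemma Halg_d1_letter [simp]: "d1_letter a \<in> Halg"
  by (cases a) auto

lemma Halg_d1_word [simp]: "d1_word w \<in> Halg"
  by (induction w) auto

lemma pairing_d1_word [simp]: "pairing f (d1_word w) = d1_dual f w"
proof (induction w arbitrary: f)
  case (Cons a w)
  then show ?case by (cases a) auto
qed simp

lemma Halg_pz [simp]: "pz \<in> Halg" "px \<in> Halg" "py \<in> Halg"
  by (auto simp: pz_def px_def py_def)

lemma Halg_d1 [simp]: "p \<in> Halg \<Longrightarrow> d1 p \<in> Halg"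
  by (simp add: d1_def)

lemma Halg_Hop [simp]: "p \<in> Halg \<Longrightarrow> Hop p \<in> Halg"
  by (simp add: Hop_def)

text \<open>What the defining rule forces when a word is cut after its first letter; the witness for
  the description in \<open>theta_word\<close>.\<close>

fun theta_rec :: "rat \<Rightarrow> word \<Rightarrow> ncpoly" where
  "theta_rec c [] = 0"
| "theta_rec c (a # w) = pmul (smul (1/2) (pmul (mon [a]) pz + pmul pz (mon [a]))) (mon w)
     + pmul (mon [a]) (theta_rec c w) + smul c (pmul (d1 (mon [a])) (Hop (mon w)))"

lemma Halg_theta_rec [simp]: "theta_rec c w \<in> Halg"
  by (induction w) auto

lemma pairing_theta_rec [simp]: "pairing f (theta_rec c w) = theta_dual (of_rat c) f w"
proof (induction w arbitrary: f)
  case (Cons a w)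
  have half: "of_rat (1 / 2) = (1 / 2 :: real)" by (simp add: of_rat_divide)
  show ?case using Cons
    by (cases a) (auto simp: pz_def px_def py_def d1_def Hop_def half field_simps)
qed simp

text \<open>Every cut is consistent with the cut after the first letter, because degrees add and
  \<open>d1\<close> is a derivation.\<close>

lemma theta_dual_append: "theta_dual c f (u @ v) = theta_dual c (\<lambda>p. f (p @ v)) u + theta_dual c (\<lambda>q. f (u @ q)) v
    + c * (real (length v) * d1_dual (\<lambda>p. f (p @ v)) u)"
  by (induction c f u rule: theta_dual.induct) (auto simp: algebra_simps)

lemma pmul_mon_Nil: "pmul p (mon []) = p" "pmul (mon []) p = p"
proof -
  have "(\<Sum>i\<le>length v. p (take i v) * mon [] (drop i v)) = (\<Sum>i\<in>{length v}. p v)" for v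
    by (rule sum.mono_neutral_cong_right) (auto simp: mon_def)
  then show "pmul p (mon []) = p" by (simp add: pmul_def)
  have "(\<Sum>i\<le>length v. mon [] (take i v) * p (drop i v)) = (\<Sum>i\<in>{0::nat}. p v)" for v
    by (rule sum.mono_neutral_cong_right) (auto simp: mon_def)
  then show "pmul (mon []) p = p" by (simp add: pmul_def)
qed

lemma theta_word_eq: "theta_word c = theta_rec c"
  unfolding theta_word_def
proof (rule the_equality, intro conjI allI)
  show "theta_rec c [X] = smul (1/2) (pmul px pz + pmul pz px)"
    "theta_rec c [Y] = smul (1/2) (pmul py pz + pmul pz py)"
    by (rule pairing_eqI; simp add: px_def py_def d1_def Hop_def)+
  show "theta_rec c (u @ v) = pmul (theta_rec c u) (mon v) + pmul (mon u) (theta_rec c v)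
      + smul c (pmul (d1 (mon u)) (Hop (mon v)))" for u v
    by (rule pairing_eqI) (simp_all add: theta_dual_append d1_def Hop_def d1_dual_lin)
next
  fix T
  assume T: "T [X] = smul (1/2) (pmul px pz + pmul pz px) \<and>
      T [Y] = smul (1/2) (pmul py pz + pmul pz py) \<and>
      (\<forall>u v. T (u @ v) = pmul (T u) (mon v) + pmul (mon u) (T v)
                          + smul c (pmul (d1 (mon u)) (Hop (mon v))))"
  have app: "T (u @ v) = pmul (T u) (mon v) + pmul (mon u) (T v)
      + smul c (pmul (d1 (mon u)) (Hop (mon v)))" for u v
    using T by blast
  \<comment> \<open>The twist vanishes here because \<open>d1\<close> kills the unit.\<close>
  have "T [] = T [] + T []"
    using app[of "[]" "[]"] by (simp add: pmul_mon_Nil d1_def fun_eq_iff smul_def pmul_def[of "\<lambda>_. 0"])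
  then have nil: "T [] = 0" by simp
  have letter: "T [a] = smul (1/2) (pmul (mon [a]) pz + pmul pz (mon [a]))" for a
    using T by (cases a) (auto simp: px_def py_def)
  have "T w = theta_rec c w" for w
  proof (induction w)
    case (Cons a w)
    then show ?case using app[of "[a]" w] by (simp add: letter)
  qed (simp add: nil)
  then show "T = theta_rec c" by auto
qed

lemma Halg_theta [simp]: "p \<in> Halg \<Longrightarrow> theta c p \<in> Halg"
  by (simp add: theta_def theta_word_eq)

lemma pairing_theta: "p \<in> Halg \<Longrightarrow> pairing f (theta c p) = pairing (theta_dual (of_rat c) f) p"
  by (simp add: theta_def theta_word_eq)

lemma comm_theta_power:
  "p \<in> Halg \<Longrightarrow> ((comm (theta c)) ^^ n) d1 p \<in> Halg \<and>
     pairing f (((comm (theta c)) ^^ n) d1 p) = pairing (ad_dual (of_rat c) n f) p"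
proof (induction n arbitrary: f p)
  case 0
  then show ?case by (simp add: d1_def)
next
  case (Suc n)
  have "pairing (\<lambda>w. g w - h w) p = pairing g p - pairing h p" for g h
    by (simp add: pairing_def sum_subtractf algebra_simps)
  then show ?case using Suc by (simp add: comm_def pairing_theta)
qed

lemma Halg_dn: "p \<in> Halg \<Longrightarrow> dn c n p \<in> Halg"
  using comm_theta_power by (simp add: dn_def)

lemma pairing_dn: "p \<in> Halg \<Longrightarrow>
  pairing f (dn c n p) = of_rat (1 / of_nat (fact (n - 1))) * pairing (ad_dual (of_rat c) (n - 1) f) p"
  using comm_theta_power by (simp add: dn_def)

text \<open>Applied twice: to indicators of words for the stability of \<open>H0\<close>, and to
  \<open>zeta_word\<close> for the vanishing of \<open>Z\<close>.\<close>

lemma pairing_dn_H0: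
  assumes "\<And>u v. u \<noteq> [] \<Longrightarrow> v \<noteq> [] \<Longrightarrow> harm (left_z (phi_dual f)) u v = 0" "p \<in> H0"
  shows "pairing f (dn c n p) = 0"
proof -
  have "ad_dual (of_rat c) (n - 1) f w = 0" if "w \<in> supp p" for w
  proof (cases w)
    case Nil
    then show ?thesis by (simp add: ad_dual_Nil)
  next
    case (Cons a u)
    then have "a = X" "last w = Y" using that assms(2) by (auto simp: H0_def)
    then show ?thesis using ad_dual_eq_0[OF assms(1), of u] Cons by (cases "u = []") auto
  qed
  then have "pairing (ad_dual (of_rat c) (n - 1) f) p = 0"
    unfolding pairing_def by (intro sum.neutral) auto
  then show ?thesis using assms(2) by (simp add: pairing_dn H0_def)
qed

lemma dn_H0:
  assumes "p \<in> H0"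
  shows "dn c n p \<in> H0"
proof -
  have H: "dn c n p \<in> Halg" using assms by (intro Halg_dn) (auto simp: H0_def)
  have "w = [] \<or> hd w = X \<and> last w = Y" if "w \<in> supp (dn c n p)" for w
  proof (rule ccontr)
    assume w: "\<not> (w = [] \<or> hd w = X \<and> last w = Y)"
    \<comment> \<open>The coefficient at a word outside \<open>H0\<close> vanishes on all of x H y,
      which meets the criterion trivially.\<close>
    define f :: "word \<Rightarrow> real" where "f = (\<lambda>v. if v = w then 1 else 0)"
    have "left_z (phi_dual f) ks = 0" if "ks \<noteq> []" for ks
    proof -
      have "phi_dual (\<lambda>u. f (X # u)) (enc ks) = phi_dual (\<lambda>_. 0) (enc ks)"
        using last_enc[OF that] w by (intro flin_cong[OF flin_phi_dual_Y]) (auto simp: f_def)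
      then show ?thesis by (simp add: left_z_phi_dual phi_dual_lin)
    qed
    then have "harm (left_z (phi_dual f)) u v = harm (\<lambda>_. 0) u v" if "u \<noteq> []" for u v
      using that by (intro flin_cong[OF flin_harm]) auto
    then have "pairing f (dn c n p) = 0"
      using assms by (intro pairing_dn_H0) (auto simp: harm_lin)
    then show False using that H by (simp add: f_def pairing_indicator supp_def)
  qed
  then show ?thesis using H by (auto simp: H0_def)
qed

subsection \<open>Completely monotone sequences\<close>

text \<open>\<open>bdiff s q k = (\<nabla>\<^sup>q s)(k)\<close> with \<open>\<nabla> = 1 - E\<close>.  Sequences are indexed from 0, so the entry \<open>n\<close>
  belongs to the argument \<open>N = n + 1\<close>.\<close>
fun bdiff :: "(nat \<Rightarrow> real) \<Rightarrow> nat \<Rightarrow> nat \<Rightarrow> real" where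
  "bdiff s 0 k = s k"
| "bdiff s (Suc q) k = bdiff s q k - bdiff s q (Suc k)"

lemma flin_bdiff: "flin UNIV (\<lambda>s. bdiff s q k)"
  by (induction q arbitrary: k) (auto intro!: flin_eval flin_minus)

lemmas bdiff_lin = flin_of[OF flin_bdiff]

text \<open>Leibniz rule for the factor N = n + 1, whose second difference is zero.\<close>

lemma bdiff_times_index:
  assumes "\<And>n. h n = real (Suc n) * g n"
  shows "bdiff h (Suc q) k = real (Suc k) * bdiff g (Suc q) k - real (Suc q) * bdiff g q (Suc k)"
proof (induction q arbitrary: k)
  case 0
  show ?case by (simp add: assms algebra_simps)
next
  case (Suc q)
  have "bdiff h (Suc (Suc q)) k = bdiff h (Suc q) k - bdiff h (Suc q) (Suc k)" by simp
  then show ?case unfolding Suc by (simp add: algebra_simps)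
qed

lemma bdiff_divide_index_0:
  "real (Suc q) * bdiff (\<lambda>n. h n / real (Suc n)) q 0 = (\<Sum>j\<le>q. bdiff h j 0)"
proof (induction q)
  case (Suc q)
  have "bdiff h (Suc q) 0 = bdiff (\<lambda>n. h n / real (Suc n)) (Suc q) 0
      - real (Suc q) * bdiff (\<lambda>n. h n / real (Suc n)) q (Suc 0)"
    using bdiff_times_index[of h "\<lambda>n. h n / real (Suc n)" q 0] by simp
  moreover have "bdiff (\<lambda>n. h n / real (Suc n)) q (Suc 0) =
      bdiff (\<lambda>n. h n / real (Suc n)) q 0 - bdiff (\<lambda>n. h n / real (Suc n)) (Suc q) 0" by simp
  ultimately have "bdiff h (Suc q) 0 = real (Suc (Suc q)) * bdiff (\<lambda>n. h n / real (Suc n)) (Suc q) 0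
     - real (Suc q) * bdiff (\<lambda>n. h n / real (Suc n)) q 0"
    by (simp only: of_nat_Suc) (simp add: algebra_simps del: bdiff.simps)
  then show ?case using Suc by (simp del: bdiff.simps)
qed simp

lemma bdiff_cumul: "bdiff (\<lambda>n. \<Sum>j\<le>n. s j) (Suc q) k = - bdiff s q (Suc k)"
  by (induction q arbitrary: k) auto

lemma bdiff_cumul_0: "bdiff (\<lambda>n. \<Sum>j\<le>n. s j) q 0 = bdiff s q 0 - (if q = 0 then 0 else bdiff s (q - 1) 0)"
  using bdiff_cumul[of s "q - 1" 0] by (cases q) auto

text \<open>At N = 1 averaging acts diagonally on differences: the sum in
  \<open>bdiff_divide_index_0\<close> telescopes.\<close>

lemma bdiff_avg_0: "real (Suc q) * bdiff (\<lambda>n. (\<Sum>j\<le>n. s j) / real (Suc n)) q 0 = bdiff s q 0"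
  unfolding bdiff_divide_index_0
  by (induction q) (auto simp del: bdiff.simps(2) simp: bdiff_cumul_0)

text \<open>Complete monotonicity, with the summability that bounds the double series in
  \<open>sum_bdiff_product_bound\<close>.\<close>

definition cmono :: "(nat \<Rightarrow> real) \<Rightarrow> bool" where
  "cmono s \<longleftrightarrow> (\<forall>q k. 0 \<le> bdiff s q k) \<and> summable (\<lambda>q. bdiff s q 0 / real (Suc q))"

lemma divide_Suc_le: "0 \<le> b \<Longrightarrow> b / real (Suc n) \<le> b"
  by (simp add: pos_divide_le_eq distrib_left)

lemma summable_avg:
  fixes a :: "nat \<Rightarrow> real"
  assumes "\<And>j. 0 \<le> a j" "summable (\<lambda>j. a j / real (Suc j))"
  shows "summable (\<lambda>q. (\<Sum>j\<le>q. a j) / real (Suc q) / real (Suc q))"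
proof (rule summableI_nonneg_bounded)
  show "0 \<le> (\<Sum>j\<le>q. a j) / real (Suc q) / real (Suc q)" for q
    using assms by (auto intro!: divide_nonneg_pos sum_nonneg)
  \<comment> \<open>The extra mean on the left closes the induction, by 1/(R+1)^2 + 1/(R+1) <=
    1/R.\<close>
  have *: "(\<Sum>q<R. (\<Sum>j\<le>q. a j) / real (Suc q) / real (Suc q)) + (\<Sum>j<R. a j) / real R
      \<le> 2 * (\<Sum>j<R. a j / real (Suc j))" for R
  proof (induction R)
    case (Suc R)
    define s where "s = (\<Sum>j<R. a j)"
    have s: "s \<ge> 0" "R = 0 \<Longrightarrow> s = 0" unfolding s_def using assms by (auto intro: sum_nonneg)
    have 1: "s / real (Suc R) / real (Suc R) + s / real (Suc R) \<le> s / real R"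
    proof (cases "R = 0")
      case False
      then have "1 / real (Suc R) / real (Suc R) + 1 / real (Suc R) \<le> 1 / real R"
      proof -
        have "1 / (real (Suc R) * real (Suc R)) \<le> 1 / (real R * real (Suc R))"
          using False by (intro frac_le mult_right_mono) auto
        also have "\<dots> = 1 / real R - 1 / real (Suc R)" using False by (simp add: field_simps)
        finally show ?thesis by simp
      qed
      from mult_left_mono[OF this s(1)] show ?thesis by (simp add: algebra_simps)
    qed (use s in simp)
    have "a R / real (Suc R) / real (Suc R) \<le> a R / real (Suc R)"
      using assms(1)[of R] by (intro divide_Suc_le) simp
    then have "(s + a R) / real (Suc R) / real (Suc R) + (s + a R) / real (Suc R) - s / real R
        \<le> 2 * (a R / real (Suc R))"
      using 1 by (simp only: add_divide_distrib)
    then show ?case using Suc by (simp add: s_def[symmetric] lessThan_Suc_atMost[symmetric] del: of_nat_Suc)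
  qed simp
  show "(\<Sum>q<R. (\<Sum>j\<le>q. a j) / real (Suc q) / real (Suc q)) \<le> 2 * (\<Sum>j. a j / real (Suc j))" for R
  proof -
    have "(\<Sum>j<R. a j / real (Suc j)) \<le> (\<Sum>j. a j / real (Suc j))"
      using assms by (intro sum_le_suminf) auto
    moreover have "(\<Sum>j<R. a j) / real R \<ge> 0" using assms by (auto intro!: divide_nonneg_nonneg sum_nonneg)
    ultimately show ?thesis using *[of R] by linarith
  qed
qed

lemma cmono_divide:
  assumes "cmono s"
  shows "cmono (\<lambda>n. s n / real (Suc n))"
proof -
  let ?g = "\<lambda>n. s n / real (Suc n)"
  have "0 \<le> bdiff ?g q k" for q k
  proof (induction q arbitrary: k)
    case 0
    then show ?case using assms unfolding cmono_def by (metis bdiff.simps(1) divide_nonneg_nonneg of_nat_0_le_iff)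
  next
    case (Suc q)
    have "real (Suc k) * bdiff ?g (Suc q) k = bdiff s (Suc q) k + real (Suc q) * bdiff ?g q (Suc k)"
      using bdiff_times_index[of s ?g q k] by simp
    also have "\<dots> \<ge> 0" using assms Suc unfolding cmono_def by (meson add_nonneg_nonneg mult_nonneg_nonneg of_nat_0_le_iff)
    finally show ?case by (simp add: zero_le_mult_iff del: bdiff.simps of_nat_Suc)
  qed
  moreover have "bdiff ?g q 0 / real (Suc q) = (\<Sum>j\<le>q. bdiff s j 0) / real (Suc q) / real (Suc q)" for q
    unfolding bdiff_divide_index_0[symmetric] by simp
  ultimately show ?thesis
    using summable_avg[of "\<lambda>j. bdiff s j 0"] assms by (simp add: cmono_def del: of_nat_Suc)
qed

text \<open>\<open>bdiff_times_index\<close> carries positivity from k to k + 1; the start k = 0 is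
  \<open>bdiff_avg_0\<close>.\<close>

lemma cmono_avg:
  assumes "cmono s"
  shows "cmono (\<lambda>n. (\<Sum>j\<le>n. s j) / real (Suc n))"
proof -
  let ?g = "\<lambda>n. (\<Sum>j\<le>n. s j) / real (Suc n)"
  have base: "bdiff ?g q 0 = bdiff s q 0 / real (Suc q)" for q
    using bdiff_avg_0[of q s] by (simp add: field_simps)
  have "0 \<le> bdiff ?g q k" for q k
  proof (induction k arbitrary: q)
    case 0
    then show ?case unfolding base using assms by (simp add: cmono_def)
  next
    case (Suc k)
    have "real (Suc q) * bdiff ?g q (Suc k) = real (Suc k) * bdiff ?g (Suc q) k + bdiff s q (Suc k)"
      using bdiff_times_index[of "\<lambda>n. \<Sum>j\<le>n. s j" ?g q k] unfolding bdiff_cumul by simp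
    also have "\<dots> \<ge> 0" using assms Suc unfolding cmono_def by (meson add_nonneg_nonneg mult_nonneg_nonneg of_nat_0_le_iff)
    finally show ?case by (simp add: zero_le_mult_iff del: bdiff.simps of_nat_Suc)
  qed
  moreover have "summable (\<lambda>q. bdiff ?g q 0 / real (Suc q))"
  proof (rule summable_comparison_test'[of "\<lambda>q. bdiff s q 0 / real (Suc q)" 0])
    show "summable (\<lambda>q. bdiff s q 0 / real (Suc q))" using assms by (simp add: cmono_def)
    show "norm (bdiff ?g q 0 / real (Suc q)) \<le> bdiff s q 0 / real (Suc q)" for q
      using assms divide_Suc_le[of "bdiff s q 0 / real (Suc q)" q] unfolding base cmono_def by auto
  qed
  ultimately show ?thesis by (simp add: cmono_def)
qed

lemma cmono_add: "cmono p \<Longrightarrow> cmono q \<Longrightarrow> cmono (\<lambda>n. p n + q n)"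
  by (auto simp: cmono_def bdiff_lin add_divide_distrib intro: summable_add)

lemma bdiff_const: "bdiff (\<lambda>_. c) (Suc q) k = 0"
  by (induction q arbitrary: k) auto

lemma cmono_const: "0 \<le> c \<Longrightarrow> cmono (\<lambda>_. c)"
proof -
  assume "0 \<le> c"
  then have "0 \<le> bdiff (\<lambda>_. c) q k" for q k by (cases q) (auto simp: bdiff_const simp del: bdiff.simps(2))
  moreover have "summable (\<lambda>q. bdiff (\<lambda>_. c) q 0 / real (Suc q))"
    by (rule summable_finite[of "{0}"]) (auto simp: bdiff_const gr0_conv_Suc simp del: bdiff.simps(2))
  ultimately show ?thesis by (simp add: cmono_def)
qed

lemma bdiff_mult: "bdiff (\<lambda>n. f n * g n) q k = (\<Sum>i\<le>q. real (q choose i) * bdiff f i k * bdiff g (q - i) (k + i))"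
proof (induction q arbitrary: k)
  case (Suc q)
  define a where "a = (\<lambda>i. bdiff f i k * bdiff g (Suc q - i) (k + i))"
  have "bdiff (\<lambda>n. f n * g n) (Suc q) k = (\<Sum>i\<le>q. real (q choose i) * bdiff f i k * bdiff g (q - i) (k + i))
      - (\<Sum>i\<le>q. real (q choose i) * bdiff f i (Suc k) * bdiff g (q - i) (Suc k + i))"
    by (simp add: Suc)
  also have "\<dots> = (\<Sum>i\<le>q. real (q choose i) * (a i + a (Suc i)))"
    unfolding sum_subtractf[symmetric]
    by (intro sum.cong refl) (auto simp: a_def Suc_diff_le algebra_simps)
  also have "\<dots> = (\<Sum>i\<le>q. real (q choose i) * a i) + (\<Sum>i\<le>q. real (q choose i) * a (Suc i))"
    by (simp add: distrib_left sum.distrib)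
  also have "(\<Sum>i\<le>q. real (q choose i) * a i) = (\<Sum>i\<le>Suc q. real (q choose i) * a i)"
    by simp
  also have "\<dots> = a 0 + (\<Sum>i\<le>q. real (q choose Suc i) * a (Suc i))"
    by (subst sum.atMost_Suc_shift) simp
  also have "\<dots> + (\<Sum>i\<le>q. real (q choose i) * a (Suc i)) = a 0 + (\<Sum>i\<le>q. real (Suc q choose Suc i) * a (Suc i))"
    by (simp add: sum.distrib[symmetric] algebra_simps)
  also have "\<dots> = (\<Sum>i\<le>Suc q. real (Suc q choose i) * a i)"
    by (subst sum.atMost_Suc_shift) simp
  finally show ?case by (simp add: a_def mult.assoc)
qed simp

text \<open>The Leibniz terms telescope in q by Pascal's rule. The result has only nonnegative terms
  when p and g are completely monotone.\<close>

lemma sum_bdiff_cumul_mult: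
  "(\<Sum>q<M. bdiff (\<lambda>n. (\<Sum>j\<le>n. p j) * g n) q 0) =
     (\<Sum>i<M. real (M choose Suc i) * bdiff p i 0 * bdiff g (M - 1 - i) i)"
proof (induction M)
  case (Suc q)
  let ?P = "\<lambda>n. \<Sum>j\<le>n. p j"
  let ?p = "\<lambda>i. bdiff p i 0"
  have "bdiff (\<lambda>n. ?P n * g n) q 0 = (\<Sum>i\<le>q. real (q choose i) * bdiff ?P i 0 * bdiff g (q - i) i)"
    by (simp add: bdiff_mult)
  also have "\<dots> = (\<Sum>i\<le>q. real (q choose i) * ?p i * bdiff g (q - i) i)
      - (\<Sum>i\<le>q. real (q choose i) * (if i = 0 then 0 else ?p (i - 1)) * bdiff g (q - i) i)"
    unfolding sum_subtractf[symmetric] bdiff_cumul_0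
    by (intro sum.cong refl) (simp add: algebra_simps)
  also have "(\<Sum>i\<le>q. real (q choose i) * (if i = 0 then 0 else ?p (i - 1)) * bdiff g (q - i) i)
      = (\<Sum>i<q. real (q choose Suc i) * ?p i * bdiff g (q - Suc i) (Suc i))"
  proof (cases q)
    case (Suc m)
    then show ?thesis
      by (simp only: sum.atMost_Suc_shift) (simp add: lessThan_Suc_atMost del: binomial_Suc_Suc)
  qed simp
  also have "\<dots> = (\<Sum>i<q. real (q choose Suc i) * ?p i * bdiff g (q - 1 - i) i)
      - (\<Sum>i<q. real (q choose Suc i) * ?p i * bdiff g (q - i) i)"
    unfolding sum_subtractf[symmetric]
  proof (intro sum.cong refl)
    fix i assume "i \<in> {..<q}"
    then have "q - i = Suc (q - Suc i)" by auto
    then have "bdiff g (q - i) i = bdiff g (q - Suc i) i - bdiff g (q - Suc i) (Suc i)" by simp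
    then show "real (q choose Suc i) * ?p i * bdiff g (q - Suc i) (Suc i) =
       real (q choose Suc i) * ?p i * bdiff g (q - 1 - i) i - real (q choose Suc i) * ?p i * bdiff g (q - i) i"
      by (simp add: right_diff_distrib)
  qed
  also have "(\<Sum>i<q. real (q choose Suc i) * ?p i * bdiff g (q - i) i) =
      (\<Sum>i\<le>q. real (q choose Suc i) * ?p i * bdiff g (q - i) i)"
    unfolding lessThan_Suc_atMost[symmetric] by simp
  finally have *: "bdiff (\<lambda>n. ?P n * g n) q 0 =
      (\<Sum>i\<le>q. real (Suc q choose Suc i) * ?p i * bdiff g (q - i) i)
      - (\<Sum>i<q. real (q choose Suc i) * ?p i * bdiff g (q - 1 - i) i)"
    by (simp add: sum.distrib algebra_simps)
  have "(\<Sum>q<Suc q. bdiff (\<lambda>n. ?P n * g n) q 0) =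
      (\<Sum>q<q. bdiff (\<lambda>n. ?P n * g n) q 0) + bdiff (\<lambda>n. ?P n * g n) q 0" by simp
  also have "\<dots> = (\<Sum>i\<le>q. real (Suc q choose Suc i) * ?p i * bdiff g (q - i) i)"
    unfolding Suc * by simp
  finally show ?case by (simp add: lessThan_Suc_atMost del: binomial_Suc_Suc)
qed simp

text \<open>Summation by parts in q lowers i by one and leaves a boundary term of favourable
  sign.\<close>

lemma sum_binomial_bdiff_le:
  assumes "\<And>q k. 0 \<le> bdiff g q k"
  shows "(\<Sum>q<R. real (i + q choose i) * bdiff g q i) \<le> (\<Sum>q<R. bdiff g q 0)"
proof (induction i)
  case (Suc i)
  have "(\<Sum>q<R. real (Suc i + q choose Suc i) * bdiff g q (Suc i)) =
      (\<Sum>q<R. real (i + q choose i) * bdiff g q i) - real (i + R choose Suc i) * bdiff g R i"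
  proof (induction R)
    case (Suc R)
    have *: "bdiff g R (Suc i) = bdiff g R i - bdiff g (Suc R) i" by simp
    have **: "real (Suc i + R choose Suc i) = real (i + R choose i) + real (i + R choose Suc i)"
      "real (i + Suc R choose Suc i) = real (i + R choose i) + real (i + R choose Suc i)"
      by simp_all
    show ?case unfolding sum.lessThan_Suc Suc * ** by (simp add: algebra_simps del: bdiff.simps)
  qed (simp add: binomial_eq_0)
  also have "\<dots> \<le> (\<Sum>q<R. real (i + q choose i) * bdiff g q i)"
    using assms by simp
  finally show ?case using Suc by linarith
qed simp

text \<open>Division by M + 1 turns the binomials into (M choose i) / (i + 1). With q = M - i the
  sum over M becomes a double sum, in which \<open>sum_binomial_bdiff_le\<close> bounds the sum over
  q uniformly in i.\<close>

lemma sum_bdiff_product_bound: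
  assumes p: "cmono p" and r: "cmono r"
  defines "L \<equiv> \<lambda>M. \<Sum>q<M. bdiff (\<lambda>n. (\<Sum>j\<le>n. p j) * ((\<Sum>j\<le>n. r j) / real (Suc n))) q 0"
  shows "summable (\<lambda>M. \<bar>L (Suc M)\<bar> / real (Suc M))"
proof (rule summableI_nonneg_bounded)
  define g where "g = (\<lambda>n. (\<Sum>j\<le>n. r j) / real (Suc n))"
  have g: "0 \<le> bdiff g q k" for q k using cmono_avg[OF r] by (simp add: cmono_def g_def)
  have p': "0 \<le> bdiff p q k" for q k using p by (simp add: cmono_def)
  have L: "L M = (\<Sum>i<M. real (M choose Suc i) * bdiff p i 0 * bdiff g (M - 1 - i) i)" for M
    unfolding L_def g_def by (rule sum_bdiff_cumul_mult)
  then have "0 \<le> L M" for M using g p' by (auto intro!: sum_nonneg mult_nonneg_nonneg)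
  have L': "\<bar>L (Suc M)\<bar> / real (Suc M) =
      (\<Sum>i\<le>M. bdiff p i 0 / real (Suc i) * (real (i + (M - i) choose i) * bdiff g (M - i) i))" for M
  proof -
    have "real (Suc M choose Suc i) / real (Suc M) = real (M choose i) / real (Suc i)" for i
      using Suc_times_binomial[of i M] by (simp add: field_simps flip: of_nat_mult del: binomial_Suc_Suc of_nat_Suc)
    then have "real (Suc M choose Suc i) * x * y / real (Suc M) = real (M choose i) / real (Suc i) * x * y" for i x y
      by (metis (no_types, lifting) times_divide_eq_left)
    then have "L (Suc M) / real (Suc M) =
       (\<Sum>i\<le>M. real (M choose i) / real (Suc i) * bdiff p i 0 * bdiff g (M - i) i)"
      unfolding L sum_divide_distrib by (simp add: lessThan_Suc_atMost del: of_nat_Suc binomial_Suc_Suc)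
    also have "\<dots> = (\<Sum>i\<le>M. bdiff p i 0 / real (Suc i) * (real (i + (M - i) choose i) * bdiff g (M - i) i))"
      by (intro sum.cong refl) simp
    finally show ?thesis using \<open>\<And>M. 0 \<le> L M\<close>[of "Suc M"] by simp
  qed
  show "0 \<le> \<bar>L (Suc M)\<bar> / real (Suc M)" for M by simp
  define C where "C = (\<Sum>q. bdiff r q 0 / real (Suc q))"
  have C: "(\<Sum>q<R. bdiff g q 0) \<le> C" for R
  proof -
    have "bdiff g q 0 = bdiff r q 0 / real (Suc q)" for q
      using bdiff_avg_0[of q r] by (simp add: g_def field_simps)
    then show ?thesis using r unfolding C_def cmono_def by (auto intro!: sum_le_suminf)
  qed
  show "(\<Sum>M<R. \<bar>L (Suc M)\<bar> / real (Suc M)) \<le> (\<Sum>i. bdiff p i 0 / real (Suc i)) * C" for R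
  proof -
    let ?a = "\<lambda>i q. bdiff p i 0 / real (Suc i) * (real (i + q choose i) * bdiff g q i)"
    have "(\<Sum>M<R. \<bar>L (Suc M)\<bar> / real (Suc M)) = (\<Sum>(i, q)\<in>{(i, q). i + q < R}. ?a i q)"
      unfolding L' sum.triangle_reindex ..
    also have "\<dots> \<le> (\<Sum>(i, q)\<in>{..<R} \<times> {..<R}. ?a i q)"
      using g p' by (intro sum_mono2) (auto intro!: mult_nonneg_nonneg divide_nonneg_nonneg)
    also have "\<dots> = (\<Sum>i<R. bdiff p i 0 / real (Suc i) * (\<Sum>q<R. real (i + q choose i) * bdiff g q i))"
      by (simp add: sum.cartesian_product[symmetric] sum_distrib_left)
    also have "\<dots> \<le> (\<Sum>i<R. bdiff p i 0 / real (Suc i) * C)"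
      using p' order.trans[OF sum_binomial_bdiff_le[OF g] C]
      by (intro sum_mono mult_left_mono) (auto intro: divide_nonneg_nonneg)
    also have "\<dots> = (\<Sum>i<R. bdiff p i 0 / real (Suc i)) * C" by (simp add: sum_distrib_right)
    also have "\<dots> \<le> (\<Sum>i. bdiff p i 0 / real (Suc i)) * C"
    proof (intro mult_right_mono sum_le_suminf)
      show "0 \<le> C" using C[of 0] by simp
    qed (use p in \<open>auto simp: cmono_def\<close>)
    finally show ?thesis .
  qed
qed

section \<open>Differences of completely monotone sequences\<close>

definition cmono_diff :: "(nat \<Rightarrow> real) \<Rightarrow> bool" where
  "cmono_diff s \<longleftrightarrow> (\<exists>p r. cmono p \<and> cmono r \<and> s = (\<lambda>n. p n - r n))"

lemma cmono_imp_cmono_diff: "cmono s \<Longrightarrow> cmono_diff s"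
  unfolding cmono_diff_def by (rule exI[of _ s], rule exI[of _ "\<lambda>_. 0"]) (auto intro: cmono_const)

lemma cmono_diff_diff:
  assumes "cmono_diff s" "cmono_diff t"
  shows "cmono_diff (\<lambda>n. s n - t n)"
proof -
  obtain p r p' r' where *: "cmono p" "cmono r" "s = (\<lambda>n. p n - r n)"
    "cmono p'" "cmono r'" "t = (\<lambda>n. p' n - r' n)"
    using assms unfolding cmono_diff_def by blast
  show ?thesis unfolding cmono_diff_def
    by (rule exI[of _ "\<lambda>n. p n + r' n"], rule exI[of _ "\<lambda>n. r n + p' n"])
       (auto simp: * intro!: cmono_add)
qed

lemma cmono_diff_divide:
  assumes "cmono_diff s"
  shows "cmono_diff (\<lambda>n. s n / real (Suc n))"
proof -
  obtain p r where *: "cmono p" "cmono r" "s = (\<lambda>n. p n - r n)"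
    using assms unfolding cmono_diff_def by blast
  show ?thesis unfolding cmono_diff_def
    by (rule exI[of _ "\<lambda>n. p n / real (Suc n)"], rule exI[of _ "\<lambda>n. r n / real (Suc n)"])
       (use *(1,2) in \<open>simp add: *(3) cmono_divide diff_divide_distrib del: of_nat_Suc\<close>)
qed

lemma cmono_diff_avg:
  assumes "cmono_diff s"
  shows "cmono_diff (\<lambda>n. (\<Sum>j\<le>n. s j) / real (Suc n))"
proof -
  obtain p r where *: "cmono p" "cmono r" "s = (\<lambda>n. p n - r n)"
    using assms unfolding cmono_diff_def by blast
  show ?thesis unfolding cmono_diff_def
    by (rule exI[of _ "\<lambda>n. (\<Sum>j\<le>n. p j) / real (Suc n)"],
        rule exI[of _ "\<lambda>n. (\<Sum>j\<le>n. r j) / real (Suc n)"])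
       (use *(1,2) in \<open>simp add: *(3) cmono_avg diff_divide_distrib sum_subtractf del: of_nat_Suc\<close>)
qed

text \<open>By bilinearity L splits into four summable cases; a nonzero limit would then make the
  harmonic series converge.\<close>

lemma sum_bdiff_product_tendsto_0:
  assumes "cmono_diff s" "cmono_diff t"
  defines "L \<equiv> \<lambda>s t M. \<Sum>q<M. bdiff (\<lambda>n. (\<Sum>j\<le>n. s j) * ((\<Sum>j\<le>n. t j) / real (Suc n))) q 0"
  assumes lim: "L s t \<longlonglongrightarrow> l"
  shows "l = 0"
proof (rule ccontr)
  assume "l \<noteq> 0"
  obtain p r p' r' where *: "cmono p" "cmono r" "s = (\<lambda>n. p n - r n)"
    "cmono p'" "cmono r'" "t = (\<lambda>n. p' n - r' n)"
    using assms(1,2) unfolding cmono_diff_def by blast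
  have eq: "L s t M = (L p p' M - L p r' M) - (L r p' M - L r r' M)" for M
    unfolding L_def * sum_subtractf[symmetric] bdiff_lin[symmetric]
    by (intro sum.cong refl arg_cong[where f = "\<lambda>h. bdiff h _ _"] ext)
       (simp add: sum_subtractf diff_divide_distrib algebra_simps)
  have "summable (\<lambda>M. \<bar>L p p' (Suc M)\<bar> / real (Suc M) + \<bar>L p r' (Suc M)\<bar> / real (Suc M) +
     (\<bar>L r p' (Suc M)\<bar> / real (Suc M) + \<bar>L r r' (Suc M)\<bar> / real (Suc M)))"
    unfolding L_def by (intro summable_add sum_bdiff_product_bound *)
  moreover have "\<forall>\<^sub>F M in sequentially. norm (\<bar>l\<bar> / 2 * inverse (real (Suc M))) \<le>
     \<bar>L p p' (Suc M)\<bar> / real (Suc M) + \<bar>L p r' (Suc M)\<bar> / real (Suc M) +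
     (\<bar>L r p' (Suc M)\<bar> / real (Suc M) + \<bar>L r r' (Suc M)\<bar> / real (Suc M))"
  proof -
    have "(\<lambda>M. \<bar>L s t (Suc M)\<bar>) \<longlonglongrightarrow> \<bar>l\<bar>"
      using LIMSEQ_Suc[OF lim] by (rule tendsto_rabs)
    moreover have "\<bar>l\<bar> / 2 < \<bar>l\<bar>" using \<open>l \<noteq> 0\<close> by simp
    ultimately have "\<forall>\<^sub>F M in sequentially. \<bar>l\<bar> / 2 < \<bar>L s t (Suc M)\<bar>"
      by (rule order_tendstoD)
    then show ?thesis
    proof eventually_elim
      case (elim M)
      have "\<bar>l\<bar> / 2 \<le> \<bar>L p p' (Suc M)\<bar> + \<bar>L p r' (Suc M)\<bar> + (\<bar>L r p' (Suc M)\<bar> + \<bar>L r r' (Suc M)\<bar>)"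
        using elim unfolding eq by linarith
      then have "\<bar>l\<bar> / 2 / real (Suc M) \<le> (\<bar>L p p' (Suc M)\<bar> + \<bar>L p r' (Suc M)\<bar> + (\<bar>L r p' (Suc M)\<bar> + \<bar>L r r' (Suc M)\<bar>)) / real (Suc M)"
        by (rule divide_right_mono) simp
      moreover have "norm (\<bar>l\<bar> / 2 * inverse (real (Suc M))) = \<bar>l\<bar> / 2 / real (Suc M)"
        unfolding divide_inverse[of _ "real (Suc M)"] real_norm_def
        by (rule abs_of_nonneg, rule mult_nonneg_nonneg) simp_all
      ultimately show ?case by (simp only: add_divide_distrib)
    qed
  qed
  ultimately have "summable (\<lambda>M. \<bar>l\<bar> / 2 * inverse (real (Suc M)))"
    by (rule summable_comparison_test_ev[rotated])
  then have "summable (\<lambda>M. inverse (real (Suc M)))"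
    using \<open>l \<noteq> 0\<close> by (subst (asm) summable_cmult_iff) auto
  then have "summable (\<lambda>M. inverse (real M))" by (subst (asm) summable_Suc_iff)
  then show False using not_summable_harmonic[where 'a = real] by simp
qed

subsection \<open>Truncated multiple zeta sums\<close>

text \<open>The part of the nested sum of a word in which the outermost index equals \<open>m\<close>.  Division by zero
  gives \<open>word_sum w 0 = 0\<close> for nonempty \<open>w\<close>, and the value at the empty word makes the recursion for
  \<open>Y\<close> produce \<open>1 / m\<close> on the last letter.\<close>
fun word_sum :: "word \<Rightarrow> nat \<Rightarrow> real" where
  "word_sum [] m = (if m = 0 then 1 else 0)"
| "word_sum (X # w) m = word_sum w m / real m"
| "word_sum (Y # w) m = (\<Sum>j<m. word_sum w j) / real m"

lemma word_sum_0: "w \<noteq> [] \<Longrightarrow> word_sum w 0 = 0"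
  by (induction w "0::nat" rule: word_sum.induct) auto

lemma sum_word_sum: "w \<noteq> [] \<Longrightarrow> (\<Sum>j\<le>n. word_sum w j) = (\<Sum>j<n. word_sum w (Suc j))"
  by (simp add: lessThan_Suc_atMost[symmetric] sum.lessThan_Suc_shift word_sum_0 del: sum.lessThan_Suc)

text \<open>The strict sum is written as an average minus its diagonal term, two operations that
  preserve \<open>cmono_diff\<close>.\<close>

lemma word_sum_Y_Suc: "w \<noteq> [] \<Longrightarrow> word_sum (Y # w) (Suc n) =
    (\<Sum>j\<le>n. word_sum w (Suc j)) / real (Suc n) - word_sum w (Suc n) / real (Suc n)"
  by (simp add: lessThan_Suc_atMost sum_word_sum diff_divide_distrib[symmetric] del: sum.lessThan_Suc of_nat_Suc)
     (simp add: lessThan_Suc_atMost[symmetric])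

lemma word_sum_Y_Nil_Suc: "word_sum [Y] (Suc n) = 1 / real (Suc n)"
  by (simp add: sum.lessThan_Suc_shift del: sum.lessThan_Suc)

lemma cmono_diff_word_sum: "w \<noteq> [] \<Longrightarrow> last w = Y \<Longrightarrow> cmono_diff (\<lambda>n. word_sum w (Suc n))"
proof (induction w)
  case (Cons a w)
  show ?case
  proof (cases "w = []")
    case True
    then have "a = Y" using Cons.prems by simp
    then show ?thesis using True cmono_diff_divide[OF cmono_imp_cmono_diff[OF cmono_const[of 1]]]
      by (simp only: word_sum_Y_Nil_Suc)
  next
    case False
    then have IH: "cmono_diff (\<lambda>n. word_sum w (Suc n))" using Cons by auto
    show ?thesis
    proof (cases a)
      case X
      then show ?thesis using cmono_diff_divide[OF IH] by simp
    next
      case Y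
      then show ?thesis using cmono_diff_diff[OF cmono_diff_avg[OF IH] cmono_diff_divide[OF IH]]
        by (simp only: word_sum_Y_Suc[OF False])
    qed
  qed
qed simp

lemma bdiff_word_sum_X: "bdiff (\<lambda>n. word_sum (X # w) (Suc n)) q 0 = (\<Sum>j\<le>q. bdiff (\<lambda>n. word_sum w (Suc n)) j 0) / real (Suc q)"
  unfolding bdiff_divide_index_0[symmetric] word_sum.simps by simp

lemma bdiff_word_sum_Y:
  assumes "w \<noteq> []"
  shows "bdiff (\<lambda>n. word_sum (Y # w) (Suc n)) q 0 = - (\<Sum>j<q. bdiff (\<lambda>n. word_sum w (Suc n)) j 0) / real (Suc q)"
proof -
  let ?t = "\<lambda>n. word_sum w (Suc n)"
  have "real (Suc q) * bdiff (\<lambda>n. word_sum (Y # w) (Suc n)) q 0 = bdiff ?t q 0 - (\<Sum>j\<le>q. bdiff ?t j 0)"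
    unfolding word_sum_Y_Suc[OF assms] bdiff_lin(2) right_diff_distrib bdiff_avg_0 bdiff_divide_index_0 ..
  also have "\<dots> = - (\<Sum>j<q. bdiff ?t j 0)"
    by (simp add: lessThan_Suc_atMost[symmetric])
  finally show ?thesis by (simp add: field_simps del: of_nat_Suc)
qed

lemma bdiff_word_sum_Y_Nil: "bdiff (\<lambda>n. word_sum [Y] (Suc n)) q 0 = 1 / real (Suc q)"
proof -
  have "(\<Sum>j\<le>q. bdiff (\<lambda>_. 1) j 0) = 1"
    by (induction q) (auto simp: bdiff_const simp del: bdiff.simps(2))
  then show ?thesis unfolding word_sum_Y_Nil_Suc
    using bdiff_divide_index_0[of q "\<lambda>_. 1"] by (simp add: field_simps)
qed

lemma phi_dual_word_sum_0: "w \<noteq> [] \<Longrightarrow> last w = Y \<Longrightarrow> phi_dual (\<lambda>u. word_sum u 0) w = 0"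
  using flin_cong[OF flin_phi_dual_Y, of w "\<lambda>u. word_sum u 0" "\<lambda>_. 0"] by (simp add: word_sum_0 phi_dual_lin)

text \<open>Duality of nested sums: up to sign, differences at N = 1 obey the recursion of
  \<open>word_sum\<close> with x replaced by z and y by -y.\<close>

lemma phi_dual_word_sum: "w \<noteq> [] \<Longrightarrow> last w = Y \<Longrightarrow>
    phi_dual (\<lambda>u. word_sum u (Suc m)) w = - bdiff (\<lambda>n. word_sum w (Suc n)) m 0"
proof (induction w arbitrary: m)
  case (Cons a w)
  show ?case
  proof (cases "w = []")
    case True
    then have "a = Y" using Cons.prems by simp
    then show ?thesis using True by (simp only: phi_dual.simps word_sum_Y_Nil_Suc bdiff_word_sum_Y_Nil[unfolded word_sum_Y_Nil_Suc])
  next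
    case False
    then have w: "w \<noteq> []" "last w = Y" using Cons by auto
    have sum: "(\<Sum>j<Suc k. phi_dual (\<lambda>u. word_sum u j) w) = - (\<Sum>j<k. bdiff (\<lambda>n. word_sum w (Suc n)) j 0)" for k
      using Cons.IH[OF w]
      by (simp add: sum.lessThan_Suc_shift phi_dual_word_sum_0[OF w] sum_negf del: sum.lessThan_Suc)
    show ?thesis
    proof (cases a)
      case X
      have "word_sum (X # u) (Suc m) + word_sum (Y # u) (Suc m) = (\<Sum>j<Suc (Suc m). word_sum u j) / real (Suc m)" for u
        by (simp add: add_divide_distrib)
      then have "phi_dual (\<lambda>u. word_sum u (Suc m)) (a # w) = (\<Sum>j<Suc (Suc m). phi_dual (\<lambda>u. word_sum u j) w) / real (Suc m)"
        using X by (simp only: phi_dual.simps phi_dual_lin flin_of_sum[OF flin_phi_dual])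
      then show ?thesis unfolding sum X bdiff_word_sum_X by (simp add: lessThan_Suc_atMost del: sum.lessThan_Suc)
    next
      case Y
      have "phi_dual (\<lambda>u. word_sum u (Suc m)) (a # w) = - (\<Sum>j<Suc m. phi_dual (\<lambda>u. word_sum u j) w) / real (Suc m)"
        using Y by (simp only: phi_dual.simps word_sum.simps phi_dual_lin flin_of_sum[OF flin_phi_dual])
      then show ?thesis unfolding sum Y bdiff_word_sum_Y[OF w(1)] by simp
    qed
  qed
qed simp

lemma word_sum_nonneg: "0 \<le> word_sum w m"
  by (induction w m rule: word_sum.induct) (auto intro!: sum_nonneg divide_nonneg_nonneg)

text \<open>Prepending a letter gives at most the average, so \<open>summable_avg\<close> propagates
  convergence.\<close>

lemma summable_word_sum: "w \<noteq> [] \<Longrightarrow> last w = Y \<Longrightarrow> summable (\<lambda>m. word_sum w (Suc m) / real (Suc m))"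
proof (induction w)
  case (Cons a w)
  show ?case
  proof (cases "w = []")
    case True
    then have "a = Y" using Cons.prems by simp
    moreover have "summable (\<lambda>m. 1 / real (Suc m) / real (Suc m))"
      using inverse_power_summable[of 2, where 'a = real] summable_Suc_iff[of "\<lambda>n. inverse (real n ^ 2)"]
      by (simp add: power2_eq_square divide_inverse del: of_nat_Suc)
    ultimately show ?thesis using True by (simp only: word_sum_Y_Nil_Suc)
  next
    case False
    then have IH: "summable (\<lambda>m. word_sum w (Suc m) / real (Suc m))" using Cons by auto
    show ?thesis
    proof (rule summable_comparison_test')
      show "summable (\<lambda>q. (\<Sum>j\<le>q. word_sum w (Suc j)) / real (Suc q) / real (Suc q))"
        by (rule summable_avg) (auto simp: word_sum_nonneg simp del: of_nat_Suc intro: IH)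
      show "norm (word_sum (a # w) (Suc q) / real (Suc q)) \<le> (\<Sum>j\<le>q. word_sum w (Suc j)) / real (Suc q) / real (Suc q)" for q
      proof -
        have "word_sum w (Suc q) \<le> (\<Sum>j\<le>q. word_sum w (Suc j))"
          using word_sum_nonneg by (intro member_le_sum) auto
        moreover have "(\<Sum>j\<le>q. word_sum w j) \<le> (\<Sum>j\<le>q. word_sum w (Suc j))"
          unfolding sum_word_sum[OF False] using word_sum_nonneg by (intro sum_mono2) auto
        ultimately have "word_sum (a # w) (Suc q) \<le> (\<Sum>j\<le>q. word_sum w (Suc j)) / real (Suc q)"
          by (cases a) (auto intro!: divide_right_mono simp: lessThan_Suc_atMost simp del: sum.lessThan_Suc)
        then have "word_sum (a # w) (Suc q) / real (Suc q) \<le> (\<Sum>j\<le>q. word_sum w (Suc j)) / real (Suc q) / real (Suc q)"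
          by (rule divide_right_mono) simp
        moreover have "0 \<le> word_sum (a # w) (Suc q) / real (Suc q)"
          using word_sum_nonneg by (rule divide_nonneg_nonneg) simp
        ultimately show ?thesis by (simp only: real_norm_def abs_of_nonneg)
      qed
    qed
  qed
qed simp

definition trunc_zeta :: "nat list \<Rightarrow> nat \<Rightarrow> real" where
  "trunc_zeta ks N = (\<Sum>m\<le>N. word_sum (enc ks) m)"

lemma word_sum_replicate: "word_sum (replicate k X @ w) m = word_sum w m / real m ^ k"
  by (induction k) auto

lemma word_sum_enc_Suc: "word_sum (enc (k # ks)) (Suc N) = trunc_zeta ks N / real (Suc N) ^ Suc k"
  by (simp add: word_sum_replicate trunc_zeta_def lessThan_Suc_atMost del: sum.lessThan_Suc)

lemma trunc_zeta_Nil [simp]: "trunc_zeta [] N = 1"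
  by (induction N) (auto simp: trunc_zeta_def)

lemma trunc_zeta_0: "trunc_zeta (k # ks) 0 = 0"
  by (simp add: trunc_zeta_def word_sum_0 del: enc.simps)

lemma trunc_zeta_Suc: "trunc_zeta (k # ks) (Suc N) = trunc_zeta (k # ks) N + trunc_zeta ks N / real (Suc N) ^ Suc k"
  unfolding trunc_zeta_def[of "k # ks"] by (simp only: sum.atMost_Suc word_sum_enc_Suc)

text \<open>The new largest index N + 1 occurs in the first factor, in the second or in both,
  matching the three terms of \<open>harm\<close>.\<close>

lemma trunc_zeta_mult: "trunc_zeta u N * trunc_zeta v N = harm (\<lambda>p. trunc_zeta p N) u v"
proof (induction u v arbitrary: N rule: harm_induct)
  case (Cons a u b v)
  show ?case
  proof (induction N)
    case 0
    show ?case by (simp add: trunc_zeta_0 harm_lin)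
  next
    case (Suc N)
    have "trunc_zeta (a # u) (Suc N) * trunc_zeta (b # v) (Suc N) = trunc_zeta (a # u) N * trunc_zeta (b # v) N
      + (trunc_zeta u N * trunc_zeta (b # v) N) / real (Suc N) ^ Suc a + (trunc_zeta (a # u) N * trunc_zeta v N) / real (Suc N) ^ Suc b
      + (trunc_zeta u N * trunc_zeta v N) / real (Suc N) ^ Suc (Suc (a + b))"
      unfolding trunc_zeta_Suc by (simp add: algebra_simps power_add del: of_nat_Suc)
    also have "\<dots> = harm (\<lambda>p. trunc_zeta p (Suc N)) (a # u) (b # v)"
      unfolding Suc Cons.IH harm.simps trunc_zeta_Suc harm_lin by simp
    finally show ?case .
  qed
qed auto

section \<open>Truncated sums and the infinite series of multiple zeta values\<close>

definition chain :: "nat \<Rightarrow> nat \<Rightarrow> nat list set" where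
  "chain l m = {ms. length ms = l \<and> sorted_wrt (>) ms \<and> (\<forall>x\<in>set ms. 0 < x \<and> x < m)}"

lemma chain_0: "chain 0 m = {[]}" by (auto simp: chain_def)

lemma chain_Suc: "chain (Suc l) m = (\<lambda>(j, ms). j # ms) ` (SIGMA j:{0<..<m}. chain l j)"
proof -
  have "ms \<in> chain (Suc l) m \<longleftrightarrow> ms \<in> (\<lambda>(j, ms). j # ms) ` (SIGMA j:{0<..<m}. chain l j)" for ms
    by (cases ms) (auto simp: chain_def image_iff)
  then show ?thesis by blast
qed

lemma finite_chain: "finite (chain l m)"
proof (rule finite_subset)
  show "chain l m \<subseteq> {ms. set ms \<subseteq> {..<m} \<and> length ms = l}" by (auto simp: chain_def)
qed (rule finite_lists_length_eq, simp)

definition mzv_term :: "nat list \<Rightarrow> nat list \<Rightarrow> real" where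
  "mzv_term ks ms = (\<Prod>i<length ks. 1 / (real (ms ! i) ^ (ks ! i)))"

lemma mzv_term_Cons: "mzv_term (k # ks) (m # ms) = 1 / real m ^ k * mzv_term ks ms"
  unfolding mzv_term_def by (simp add: prod.lessThan_Suc_shift del: prod.lessThan_Suc)

lemma mzv_term_nonneg: "0 \<le> mzv_term ks ms"
  unfolding mzv_term_def by (intro prod_nonneg) auto

lemma sum_mzv_term_chain: "(\<Sum>ms\<in>chain (length ks) (Suc N). mzv_term (map Suc ks) ms) = trunc_zeta ks N"
proof (induction ks arbitrary: N)
  case Nil
  show ?case by (simp add: chain_0 mzv_term_def)
next
  case (Cons k ks)
  have "(\<Sum>ms\<in>chain (length (k # ks)) (Suc N). mzv_term (map Suc (k # ks)) ms)
     = (\<Sum>(j, ms)\<in>(SIGMA j:{0<..<Suc N}. chain (length ks) j). 1 / real j ^ Suc k * mzv_term (map Suc ks) ms)"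
    unfolding list.size add_0_right add_Suc_right chain_Suc
    by (subst sum.reindex) (auto simp: inj_on_def mzv_term_Cons case_prod_beta)
  also have "\<dots> = (\<Sum>j\<in>{0<..<Suc N}. 1 / real j ^ Suc k * (\<Sum>ms\<in>chain (length ks) j. mzv_term (map Suc ks) ms))"
    by (subst sum.Sigma[symmetric]) (auto simp: finite_chain sum_distrib_left)
  also have "\<dots> = (\<Sum>j<N. 1 / real (Suc j) ^ Suc k * trunc_zeta ks j)"
    unfolding Cons[symmetric]
    by (rule sum.reindex_bij_witness[of _ Suc "\<lambda>j. j - 1"]) auto
  also have "\<dots> = (\<Sum>j<N. word_sum (enc (k # ks)) (Suc j))"
    unfolding word_sum_enc_Suc by simp
  also have "\<dots> = trunc_zeta (k # ks) N"
    unfolding trunc_zeta_def by (rule sum_word_sum[symmetric]) simp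
  finally show ?case .
qed

lemma blocks_replicate: "blocks j (replicate k X @ w) = blocks (j + k) w"
  by (induction k arbitrary: j) auto

lemma blocks_enc: "blocks 0 (enc ks) = map Suc ks"
  by (induction ks) (auto simp: blocks_replicate)

text \<open>Index tuples are grouped by their outermost entry m + 1; the terms are nonnegative, so
  regrouping is legitimate.\<close>

lemma zeta_word_sums:
  assumes "u \<noteq> []" "last u = Y"
  shows "(\<lambda>m. word_sum u (Suc m) / real (Suc m)) sums zeta_word (X # u)"
proof -
  obtain k ks where u: "u = enc (k # ks)"
    using enc_surj[of u] assms by (metis enc.simps(1) neq_Nil_conv)
  define S where "S = (\<Sum>m. word_sum u (Suc m) / real (Suc m))"
  have S: "(\<lambda>m. word_sum u (Suc m) / real (Suc m)) sums S"
    unfolding S_def using summable_word_sum[OF assms] by (rule summable_sums)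
  let ?D = "SIGMA m:UNIV. chain (length ks) (Suc m)"
  \<comment> \<open>The prepended x makes the first exponent k + 2.\<close>
  let ?A = "{ms. length ms = length ((k + 2) # map Suc ks) \<and> sorted_wrt (>) ms \<and> (\<forall>m\<in>set ms. 0 < m)}"
  let ?f = "mzv_term ((k + 2) # map Suc ks)"
  have A: "?A = (\<lambda>(m, ms). Suc m # ms) ` ?D"
  proof -
    have "ms \<in> ?A \<longleftrightarrow> ms \<in> (\<lambda>(m, ms). Suc m # ms) ` ?D" for ms
    proof (cases ms)
      case (Cons j ms')
      have "ms \<in> ?A \<longleftrightarrow> 0 < j \<and> ms' \<in> chain (length ks) j"
        by (auto simp: Cons chain_def)
      moreover have "ms \<in> (\<lambda>(m, ms). Suc m # ms) ` ?D \<longleftrightarrow> (\<exists>m. j = Suc m \<and> ms' \<in> chain (length ks) j)"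
        by (auto simp: Cons)
      ultimately show ?thesis by (auto simp: gr0_conv_Suc)
    qed auto
    then show ?thesis by blast
  qed
  have inner: "((\<lambda>ms. (?f \<circ> (\<lambda>(m, ms). Suc m # ms)) (m, ms)) has_sum word_sum u (Suc m) / real (Suc m))
      (chain (length ks) (Suc m))" for m
  proof -
    have "(\<Sum>ms\<in>chain (length ks) (Suc m). (?f \<circ> (\<lambda>(m, ms). Suc m # ms)) (m, ms))
       = 1 / real (Suc m) ^ (k + 2) * trunc_zeta ks m"
      by (simp add: mzv_term_Cons sum_divide_distrib[symmetric] sum_mzv_term_chain del: of_nat_Suc)
    also have "\<dots> = word_sum u (Suc m) / real (Suc m)"
      unfolding u word_sum_enc_Suc by (simp add: field_simps del: of_nat_Suc)
    finally have eq: "(\<Sum>ms\<in>chain (length ks) (Suc m). (?f \<circ> (\<lambda>(m, ms). Suc m # ms)) (m, ms))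
       = word_sum u (Suc m) / real (Suc m)" .
    show ?thesis unfolding eq[symmetric] by (rule has_sum_finite[OF finite_chain])
  qed
  have outer: "((\<lambda>m. word_sum u (Suc m) / real (Suc m)) has_sum S) UNIV"
    using S word_sum_nonneg by (intro sums_nonneg_imp_has_sum) auto
  have "((?f \<circ> (\<lambda>(m, ms). Suc m # ms)) has_sum S) ?D"
  proof (rule has_sum_SigmaI[OF inner outer])
    show "(?f \<circ> (\<lambda>(m, ms). Suc m # ms)) summable_on ?D"
      by (rule summable_on_SigmaI[OF inner has_sum_imp_summable[OF outer]])
         (simp add: mzv_term_nonneg)
  qed
  then have "(?f has_sum S) ?A"
    unfolding A by (subst has_sum_reindex) (auto simp: inj_on_def)
  then have "mzv ((k + 2) # map Suc ks) = S"
    unfolding mzv_def mzv_term_def by (rule infsumI)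
  moreover have "zeta_word (X # u) = mzv ((k + 2) # map Suc ks)"
    by (simp add: zeta_word_def u blocks_replicate blocks_enc)
  ultimately show ?thesis using S by simp
qed

section \<open>The linear part of Kawashima's relation\<close>

lemma left_z_phi_dual_zeta_tendsto:
  assumes "ks \<noteq> []"
  shows "(\<lambda>M. - (\<Sum>q<M. bdiff (\<lambda>n. trunc_zeta ks (Suc n) / real (Suc n)) q 0)) \<longlonglongrightarrow> left_z (phi_dual zeta_word) ks"
proof -
  let ?w = "enc ks"
  have w: "?w \<noteq> []" "last ?w = Y" using last_enc[OF assms] by auto
  have "(\<lambda>M. phi_dual (\<lambda>u. \<Sum>m<M. word_sum u (Suc m) / real (Suc m)) ?w) \<longlonglongrightarrow> phi_dual (\<lambda>u. zeta_word (X # u)) ?w"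
    using zeta_word_sums by (intro flin_tendsto[OF flin_phi_dual_Y[OF w]]) (auto simp: sums_def)
  also have "(\<lambda>M. phi_dual (\<lambda>u. \<Sum>m<M. word_sum u (Suc m) / real (Suc m)) ?w) =
      (\<lambda>M. - (\<Sum>q<M. bdiff (\<lambda>n. trunc_zeta ks (Suc n) / real (Suc n)) q 0))"
  proof
    fix M
    have "trunc_zeta ks (Suc n) = (\<Sum>j\<le>n. word_sum ?w (Suc j))" for n
      unfolding trunc_zeta_def sum_word_sum[OF w(1)] by (simp add: lessThan_Suc_atMost)
    \<comment> \<open>This turns the differences from the duality, once divided by q + 1, into
      differences of S_w(N)/N.\<close>
    then have *: "real (Suc q) * bdiff (\<lambda>n. trunc_zeta ks (Suc n) / real (Suc n)) q 0 = bdiff (\<lambda>n. word_sum ?w (Suc n)) q 0" for q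
      using bdiff_avg_0[of q "\<lambda>n. word_sum ?w (Suc n)"] by simp
    have "bdiff (\<lambda>n. word_sum ?w (Suc n)) q 0 / real (Suc q) = bdiff (\<lambda>n. trunc_zeta ks (Suc n) / real (Suc n)) q 0" for q
      unfolding *[symmetric] by simp
    then show "phi_dual (\<lambda>u. \<Sum>m<M. word_sum u (Suc m) / real (Suc m)) ?w =
      - (\<Sum>q<M. bdiff (\<lambda>n. trunc_zeta ks (Suc n) / real (Suc n)) q 0)"
      by (simp only: flin_of_sum[OF flin_phi_dual] phi_dual_lin phi_dual_word_sum[OF w] minus_divide_left[symmetric] sum_negf)
  qed
  finally show ?thesis by (simp add: left_z_phi_dual)
qed

text \<open>By \<open>trunc_zeta_mult\<close> the approximants are those of a product of partial
  sums; their limit exists, so \<open>sum_bdiff_product_tendsto_0\<close> forces it to be 0.\<close>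

lemma harm_zeta:
  assumes "u \<noteq> []" "v \<noteq> []"
  shows "harm (left_z (phi_dual zeta_word)) u v = 0"
proof -
  let ?t = "\<lambda>ks n. word_sum (enc ks) (Suc n)"
  let ?L = "\<lambda>M. \<Sum>q<M. bdiff (\<lambda>n. (\<Sum>j\<le>n. ?t u j) * ((\<Sum>j\<le>n. ?t v j) / real (Suc n))) q 0"
  have trunc_zeta: "trunc_zeta ks (Suc n) = (\<Sum>j\<le>n. ?t ks j)" if "ks \<noteq> []" for ks n
    using that unfolding trunc_zeta_def by (subst sum_word_sum) (auto simp: lessThan_Suc_atMost)
  have "(\<lambda>M. harm (\<lambda>ks. - (\<Sum>q<M. bdiff (\<lambda>n. trunc_zeta ks (Suc n) / real (Suc n)) q 0)) u v)
      \<longlonglongrightarrow> harm (left_z (phi_dual zeta_word)) u v"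
    using assms left_z_phi_dual_zeta_tendsto by (intro flin_tendsto[OF flin_harm]) auto
  also have "(\<lambda>M. harm (\<lambda>ks. - (\<Sum>q<M. bdiff (\<lambda>n. trunc_zeta ks (Suc n) / real (Suc n)) q 0)) u v) = (\<lambda>M. - ?L M)"
  proof
    fix M
    have "harm (\<lambda>ks. bdiff (\<lambda>n. trunc_zeta ks (Suc n) / real (Suc n)) q 0) u v =
        bdiff (\<lambda>n. (\<Sum>j\<le>n. ?t u j) * ((\<Sum>j\<le>n. ?t v j) / real (Suc n))) q 0" for q
      by (subst flin_swap[OF flin_harm flin_bdiff])
         (simp only: harm_lin trunc_zeta_mult[symmetric] trunc_zeta[OF assms(1)] trunc_zeta[OF assms(2)] times_divide_eq_right)
    then show "harm (\<lambda>ks. - (\<Sum>q<M. bdiff (\<lambda>n. trunc_zeta ks (Suc n) / real (Suc n)) q 0)) u v = - ?L M"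
      by (simp only: harm_lin flin_of_sum[OF flin_harm])
  qed
  finally have "?L \<longlonglongrightarrow> - harm (left_z (phi_dual zeta_word)) u v"
    using tendsto_minus by fastforce
  from sum_bdiff_product_tendsto_0[OF _ _ this] show ?thesis
    using last_enc assms by (simp add: cmono_diff_word_sum)
qed

theorem mainTheorem1:
  fixes n :: nat and c :: rat
  assumes "n \<ge> 1"
  shows "dn c n ` H0 \<subseteq> H0 \<and> (\<forall>w\<in>H0. Z (dn c n w) = 0)"
proof -
  have "Z p = pairing zeta_word p" for p by (simp add: Z_def pairing_def)
  then show ?thesis using dn_H0 pairing_dn_H0[OF harm_zeta] by auto
qed

end
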